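(* $\mathrm{Fin}(11)=\mathrm{Adm}(11)\setminus\{(3,0),(4,0),(4,6),(5,0),(5,1),(5,2),(6,0),(6,1),(6,3),(6,4)\}$.
   Context: $K_4-e$ is the graph on four vertices $a,b,c,d$ with edges $ab,ac,ad,bc,bd$; it is denoted $[a,b,c-d]$. A $(K_4-e)$-design of order $v$ is a pair $(X,\mathcal B)$ where $X$ is a set of $v$ vertices and $\mathcal B$ is a collection of copies of $K_4-e$ (blocks) with vertices in $X$ whose edge sets partition the edges of $K_v$ on $X$; it has $b_v=v(v-1)/10$ blocks. For a graph $B$, $T(B)$ is the set of its triangles (3-vertex subsets inducing a triangle); e.g. $T([a,b,c-d])=\{\{a,b,c\},\{a,b,d\}\}$, and $T(\mathcal B)=\bigcup_{B\in\mathcal B}T(B)$. Two designs $(X,\mathcal B_1),(X,\mathcal B_2)$ on the same vertex set intersect in $s$ blocks if $|\mathcal B_1\cap\mathcal B_2|=s$, and in $t$ triangles if $|T(\mathcal B_1)\cap T(\mathcal B_2)|=t$. Define $\mathrm{Fin}(v)=\{(s,t):$ there exists a pair of $(K_4-e)$-designs of order $v$ on the same vertex set intersecting in $s$ blocks and $t+2s$ triangles$\}$; $J(v)=\{s:$ there is a pair of $(K_4-e)$-designs of order $v$ intersecting in $s$ blocks$\}$; $J_T(v)=\{t:$ there is a pair of $(K_4-e)$-designs of order $v$ intersecting in $t$ triangles$\}$; and $\mathrm{Adm}(v)=\{(s,t): s,t\ge 0,\ s+t\le b_v,\ s\in J(v),\ t+2s\in J_T(v)\}$. (Known from the literature: $J(11)=\{0,1,\dots,6,11\}$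 and $J_T(11)=\{0,1,\dots,16,22\}$.) *)

theory Defs
  imports Main
begin

text \<open>A copy of K4-e, [a,b,c-d], represented by its edge set (edges are 2-element sets).\<close>
definition kite :: "'a \<Rightarrow> 'a \<Rightarrow> 'a \<Rightarrow> 'a \<Rightarrow> 'a set set" where
  "kite a b c d = {{a,b},{a,c},{a,d},{b,c},{b,d}}"

definition is_block :: "'a set \<Rightarrow> 'a set set \<Rightarrow> bool" where
  "is_block X B \<longleftrightarrow> (\<exists>a b c d. distinct [a,b,c,d] \<and> {a,b,c,d} \<subseteq> X \<and> B = kite a b c d)"

definition is_design :: "'a set \<Rightarrow> 'a set set set \<Rightarrow> bool" where
  "is_design X \<B> \<longleftrightarrow> finite X \<and> (\<forall>B\<in>\<B>. is_block X B) \<and>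
     (\<forall>x\<in>X. \<forall>y\<in>X. x \<noteq> y \<longrightarrow> (\<exists>!B. B \<in> \<B> \<and> {x,y} \<in> B))"

definition triangles :: "'a set set \<Rightarrow> 'a set set" where
  "triangles B = {S. card S = 3 \<and> (\<forall>x\<in>S. \<forall>y\<in>S. x \<noteq> y \<longrightarrow> {x,y} \<in> B)}"

definition triangles_of :: "'a set set set \<Rightarrow> 'a set set" where
  "triangles_of \<B> = (\<Union>B\<in>\<B>. triangles B)"

definition b_num :: "nat \<Rightarrow> nat" where
  "b_num v = v * (v - 1) div 10"

definition Fin :: "nat \<Rightarrow> (nat \<times> nat) set" where
  "Fin v = {(s,t). \<exists>(X::nat set) \<B>1 \<B>2. card X = v \<and> is_design X \<B>1 \<and> is_design X \<B>2 \<and>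
      card (\<B>1 \<inter> \<B>2) = s \<and> card (triangles_of \<B>1 \<inter> triangles_of \<B>2) = t + 2 * s}"

definition J :: "nat \<Rightarrow> nat set" where
  "J v = {s. \<exists>(X::nat set) \<B>1 \<B>2. card X = v \<and> is_design X \<B>1 \<and> is_design X \<B>2 \<and>
      card (\<B>1 \<inter> \<B>2) = s}"

definition J_T :: "nat \<Rightarrow> nat set" where
  "J_T v = {t. \<exists>(X::nat set) \<B>1 \<B>2. card X = v \<and> is_design X \<B>1 \<and> is_design X \<B>2 \<and>
      card (triangles_of \<B>1 \<inter> triangles_of \<B>2) = t}"

definition Adm :: "nat \<Rightarrow> (nat \<times> nat) set" where
  "Adm v = {(s,t). s + t \<le> b_num v \<and> s \<in> J v \<and> t + 2 * s \<in> J_T v}"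

end

(* A degree count (3a + 2b = 10 at every vertex, with the a's summing to 22) shows that every vertex is
   an end of exactly two central edges, so the central edges form a 2-regular graph. Along one of its cycles
   p(0), p(1), ..., the pair {p(i), p(i+2)} can be covered in only two ways, and the choice propagates around
   the cycle; this excludes the lengths 4, 5, 6 and 8, hence the cycle is Hamiltonian, and the same propagation
   for pairs at distance 4 leaves, up to isomorphism, only the two designs [i, i+1, (i+3)-(i+5)] and
   [i, i+1, (i+3)-(i+7)] modulo 11. Two designs with at least three common blocks have two common blocks at
   cyclic distance at most 3, so a small search over the bijections between the two cycles finds every
   possible pair of parameters. The remaining parameters are realised by explicit bijections. *)
theory Submission
  imports Defs
begin

subsection \<open>Vertex degrees and the central graph\<close>

text \<open>A pair that is not a central edge joins an end of a central edge to another vertex of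
  its block. Along a central cycle there are thus four options: either vertex may be the end, and
  either of its cycle neighbours completes the central edge. At distance two, and then at distance
  four, two options contradict a central edge or an already covered pair; this is why two ways
  remain and the choice propagates. Length 3 escapes the argument, but 11 is not a sum of several
  numbers from 3, 7, 9, 10. The obstacle to excluding parameters is the number 11! of bijections.
  For s \<le> 2 only the bound s + t \<le> 11 is needed, so just s \<ge> 3 is searched. Rotating
  both cycles makes one common block the base block of either design, with 2 * 2 matchings on it;
  the second, nearby common block prunes the remaining 7! extensions. Distance 3 comes from 4 * 3 >
  11.\<close>

lemma kite_mem: "{x,y} \<in> kite a b c d \<longleftrightarrow>
    {x,y} = {a,b} \<or> {x,y} = {a,c} \<or> {x,y} = {a,d} \<or> {x,y} = {b,c} \<or> {x,y} = {b,d}"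
  by (simp add: kite_def)

lemma kite_swap_center: "kite b a c d = kite a b c d"
  by (auto simp: kite_def insert_commute)

lemma kite_swap_wings: "kite a b d c = kite a b c d"
  by (auto simp: kite_def insert_commute)

lemma triangles_kite:
  assumes "distinct [a,b,c,d]"
  shows "triangles (kite a b c d) = {{a,b,c},{a,b,d}}"
proof (intro equalityI subsetI)
  fix S assume "S \<in> triangles (kite a b c d)"
  then have "card S = 3" and S: "\<forall>x\<in>S. \<forall>y\<in>S. x \<noteq> y \<longrightarrow> {x,y} \<in> kite a b c d"
    by (auto simp: triangles_def)
  then obtain x y z where xyz: "S = {x,y,z}" "x \<noteq> y" "x \<noteq> z" "y \<noteq> z"
    by (auto simp: card_3_iff)
  have "{x,y} \<in> kite a b c d" "{x,z} \<in> kite a b c d" "{y,z} \<in> kite a b c d"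
    using S xyz by auto
  then show "S \<in> {{a,b,c},{a,b,d}}"
    unfolding kite_mem xyz(1) using assms xyz(2-)
    by (auto simp: doubleton_eq_iff)
next
  fix S assume "S \<in> {{a,b,c},{a,b,d}}"
  then show "S \<in> triangles (kite a b c d)"
    using assms by (auto simp: triangles_def kite_mem doubleton_eq_iff)
qed

lemma card_triangles_kite:
  assumes "distinct [a,b,c,d]"
  shows "card (triangles (kite a b c d)) = 2"
proof -
  have "{a,b,c} \<noteq> {a,b,d}" using assms by auto
  then show ?thesis by (simp add: triangles_kite[OF assms])
qed

text \<open>The central edge is the intersection of the two triangles of a kite.\<close>
lemma triangles_kite_eqD:
  assumes "distinct [a,b,c,d]" "distinct [a',b',c',d']"
    and "triangles (kite a b c d) = triangles (kite a' b' c' d')"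
  shows "{a,b} = {a',b'}" "{c,d} = {c',d'}"
proof -
  have *: "{a,b} = \<Inter>(triangles (kite a b c d))" "{c,d} = \<Union>(triangles (kite a b c d)) - \<Inter>(triangles (kite a b c d))"
    if "distinct [a,b,c,d]" for a b c d :: 'a
    using that by (auto simp: triangles_kite)
  show "{a,b} = {a',b'}" "{c,d} = {c',d'}"
    using *[OF assms(1)] *[OF assms(2)] assms(3) by simp_all
qed

lemma kite_eqD:
  assumes "distinct [a,b,c,d]" "distinct [a',b',c',d']" "kite a b c d = kite a' b' c' d'"
  shows "{a,b} = {a',b'}" "{c,d} = {c',d'}"
  using triangles_kite_eqD[OF assms(1,2)] assms(3) by simp_all

lemma kite_eq_iff:
  assumes "distinct [a,b,c,d]" "distinct [a',b',c',d']"
  shows "kite a b c d = kite a' b' c' d' \<longleftrightarrow> {a,b} = {a',b'} \<and> {c,d} = {c',d'}"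
  using kite_eqD[OF assms] by (auto simp: doubleton_eq_iff kite_swap_center kite_swap_wings)

lemma kite_neighbours:
  assumes "distinct [a,b,c,d]"
  shows "{y. {a,y} \<in> kite a b c d} = {b,c,d}" "{y. {b,y} \<in> kite a b c d} = {a,c,d}"
    "{y. {c,y} \<in> kite a b c d} = {a,b}" "{y. {d,y} \<in> kite a b c d} = {a,b}"
    "x \<notin> {a,b,c,d} \<Longrightarrow> {y. {x,y} \<in> kite a b c d} = {}"
  using assms by (auto simp: kite_mem doubleton_eq_iff)

definition nbrs :: "'a set set \<Rightarrow> 'a \<Rightarrow> 'a set" where
  "nbrs B x = {y. {x,y} \<in> B}"

lemma kite_degrees:
  assumes "distinct [a,b,c,d]"
  shows "card (nbrs (kite a b c d) x) = (if x \<in> {a,b} then 3 else if x \<in> {c,d} then 2 else 0)"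
proof -
  consider "x = a" | "x = b" | "x = c" | "x = d" | "x \<notin> {a,b,c,d}" by auto
  then show ?thesis
    using assms by cases (auto simp: nbrs_def kite_neighbours[OF assms])
qed

lemma card_Collect_sum: "finite A \<Longrightarrow> card {x\<in>A. P x} = (\<Sum>x\<in>A. if P x then 1 else 0)"
  unfolding card_eq_sum by (rule sum.inter_filter)

section \<open>Degree counting in a design of order 11\<close>

locale design11 =
  fixes X :: "'a set" and D :: "'a set set set"
  assumes des: "is_design X D" and card_X: "card X = 11"
begin

lemma finite_X: "finite X" using des by (simp add: is_design_def)

lemma blockE:
  assumes "B \<in> D"
  obtains a b c d where "distinct [a,b,c,d]" "{a,b,c,d} \<subseteq> X" "B = kite a b c d"
proof -
  have "is_block X B" using assms des by (simp add: is_design_def)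
  then obtain a b c d where "distinct [a,b,c,d] \<and> {a,b,c,d} \<subseteq> X \<and> B = kite a b c d"
    unfolding is_block_def by (elim exE)
  then show thesis using that by (elim conjE)
qed

lemma edge_X:
  assumes "B \<in> D" "{x,y} \<in> B"
  shows "x \<in> X" "y \<in> X" "x \<noteq> y"
proof -
  obtain a b c d where "distinct [a,b,c,d]" "{a,b,c,d} \<subseteq> X" "B = kite a b c d"
    using blockE[OF assms(1)] .
  with assms(2) show "x \<in> X" "y \<in> X" "x \<noteq> y" by (auto simp: kite_mem doubleton_eq_iff)
qed

lemma block_unique: "B \<in> D \<Longrightarrow> B' \<in> D \<Longrightarrow> {x,y} \<in> B \<Longrightarrow> {x,y} \<in> B' \<Longrightarrow> B = B'"
  using edge_X[of B x y] des unfolding is_design_def by metis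

lemma block_exists: "x \<in> X \<Longrightarrow> y \<in> X \<Longrightarrow> x \<noteq> y \<Longrightarrow> \<exists>B\<in>D. {x,y} \<in> B"
  using des unfolding is_design_def by blast

lemma finite_D: "finite D"
proof (rule finite_subset)
  show "D \<subseteq> Pow (Pow X)"
  proof
    fix B assume "B \<in> D"
    then obtain a b c d where "{a,b,c,d} \<subseteq> X" "B = kite a b c d" by (rule blockE)
    then show "B \<in> Pow (Pow X)" by (auto simp: kite_def)
  qed
  show "finite (Pow (Pow X))" using finite_X by simp
qed

lemma nbrs_X: "B \<in> D \<Longrightarrow> nbrs B x \<subseteq> X - {x}"
  using edge_X unfolding nbrs_def by blast

text \<open>The neighbourhoods of \<open>x\<close> in the blocks partition the other ten vertices,
  since each pair lies in exactly one block.\<close>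

lemma degree_sum:
  assumes "x \<in> X" shows "(\<Sum>B\<in>D. card (nbrs B x)) = 10"
proof -
  have "(\<Sum>B\<in>D. card (nbrs B x)) = card (\<Union>B\<in>D. nbrs B x)"
  proof (rule card_UN_disjoint[symmetric])
    show "\<forall>B\<in>D. finite (nbrs B x)"
      using nbrs_X finite_X by (meson finite_Diff finite_subset)
    show "\<forall>B\<in>D. \<forall>B'\<in>D. B \<noteq> B' \<longrightarrow> nbrs B x \<inter> nbrs B' x = {}"
      unfolding nbrs_def using block_unique by blast
  qed (rule finite_D)
  also have "(\<Union>B\<in>D. nbrs B x) = X - {x}"
  proof
    show "(\<Union>B\<in>D. nbrs B x) \<subseteq> X - {x}" using nbrs_X by blast
    show "X - {x} \<subseteq> (\<Union>B\<in>D. nbrs B x)"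
      using block_exists[OF assms] unfolding nbrs_def by blast
  qed
  also have "card (X - {x}) = 10" using assms card_X finite_X by simp
  finally show ?thesis .
qed

text \<open>Read off from degrees, so that no representation \<open>kite a b c d\<close> of the
  block has to be chosen.\<close>

definition centres :: "'a set set \<Rightarrow> 'a set" where "centres B = {x. card (nbrs B x) = 3}"
definition wings :: "'a set set \<Rightarrow> 'a set" where "wings B = {x. card (nbrs B x) = 2}"

lemma centres_kite: "distinct [a,b,c,d] \<Longrightarrow> centres (kite a b c d) = {a,b}"
  by (simp only: centres_def kite_degrees) auto

lemma wings_kite: "distinct [a,b,c,d] \<Longrightarrow> wings (kite a b c d) = {c,d}"
  by (simp only: wings_def kite_degrees) auto

lemma card_block:
  assumes "B \<in> D" shows "card (X \<inter> centres B) = 2" "card (X \<inter> wings B) = 2"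
proof -
  obtain a b c d where *: "distinct [a,b,c,d]" "{a,b,c,d} \<subseteq> X" "B = kite a b c d"
    using blockE[OF assms] .
  have "X \<inter> {a,b} = {a,b}" "X \<inter> {c,d} = {c,d}" using *(2) by auto
  then show "card (X \<inter> centres B) = 2" "card (X \<inter> wings B) = 2"
    using *(1) unfolding *(3) by (simp_all add: centres_kite[OF *(1)] wings_kite[OF *(1)])
qed

lemma double_count:
  assumes "\<And>B. B \<in> D \<Longrightarrow> card (X \<inter> f B) = 2"
  shows "(\<Sum>x\<in>X. card {B\<in>D. x \<in> f B}) = 2 * card D"
proof -
  have "(\<Sum>x\<in>X. card {B\<in>D. x \<in> f B}) = (\<Sum>x\<in>X. \<Sum>B\<in>D. if x \<in> f B then 1 else 0)"
    by (simp only: card_Collect_sum[OF finite_D])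
  also have "\<dots> = (\<Sum>B\<in>D. \<Sum>x\<in>X. if x \<in> f B then 1 else 0)" by (rule sum.swap)
  also have "\<dots> = (\<Sum>B\<in>D. card (X \<inter> f B))"
    by (simp only: card_Collect_sum[OF finite_X, symmetric] Int_def)
  also have "\<dots> = (\<Sum>B\<in>D. 2)" using assms by (intro sum.cong) auto
  finally show ?thesis by simp
qed

lemma vertex_count:
  assumes "x \<in> X"
  shows "3 * card {B\<in>D. x \<in> centres B} + 2 * card {B\<in>D. x \<in> wings B} = 10"
proof -
  have "card (nbrs B x) = 3 * (if x \<in> centres B then 1 else 0) + 2 * (if x \<in> wings B then 1 else 0)"
    if "B \<in> D" for B
    by (rule blockE[OF that]) (auto simp: kite_degrees centres_kite wings_kite)
  then have "(10::nat) = (\<Sum>B\<in>D. 3 * (if x \<in> centres B then 1 else 0) + 2 * (if x \<in> wings B then 1 else 0))"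
    using degree_sum[OF assms] by simp
  also have "\<dots> = 3 * (\<Sum>B\<in>D. if x \<in> centres B then 1 else 0) + 2 * (\<Sum>B\<in>D. if x \<in> wings B then 1 else 0)"
    by (simp add: sum.distrib sum_distrib_left)
  also have "\<dots> = 3 * card {B\<in>D. x \<in> centres B} + 2 * card {B\<in>D. x \<in> wings B}"
    by (simp only: card_Collect_sum[OF finite_D])
  finally show ?thesis by simp
qed

lemma card_D: "card D = 11"
proof -
  have "(\<Sum>x\<in>X. 3 * card {B\<in>D. x \<in> centres B} + 2 * card {B\<in>D. x \<in> wings B}) = (\<Sum>x\<in>X. 10)"
    using vertex_count by (intro sum.cong) auto
  then have "3 * (\<Sum>x\<in>X. card {B\<in>D. x \<in> centres B}) + 2 * (\<Sum>x\<in>X. card {B\<in>D. x \<in> wings B}) = 110"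
    by (simp add: sum.distrib card_X flip: sum_distrib_left)
  \<comment> \<open>Both inner sums equal \<open>2 * card D\<close>, so the equation is 10 *
    \<open>card D\<close> = 110.\<close>
  then show ?thesis
    using double_count[of centres] double_count[of wings] card_block by simp
qed

text \<open>In 3a + 2b = 10 the number a is even, hence 0 or 2. The average over the 11 vertices is
  22 / 11 = 2, so no vertex can fall below the maximum.\<close>

lemma two_centres:
  assumes "x \<in> X" shows "card {B\<in>D. x \<in> centres B} = 2"
proof -
  have le: "card {B\<in>D. x \<in> centres B} \<le> 2" if "x \<in> X" for x
    using vertex_count[OF that] by presburger
  have "(\<Sum>x\<in>X. card {B\<in>D. x \<in> centres B}) = 22"
    using double_count[of centres] card_block card_D by simp
  also have "\<dots> = (\<Sum>x\<in>X. 2)" by (simp add: card_X)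
  finally show ?thesis
    using le assms finite_X by (meson sum_mono_inv)
qed

section \<open>Central edges and wings\<close>

definition cen :: "'a \<Rightarrow> 'a \<Rightarrow> bool" where
  "cen x y \<longleftrightarrow> (\<exists>c d. distinct [x,y,c,d] \<and> kite x y c d \<in> D)"
text \<open>One triangle of a block, with its central edge named first. By
  \<open>kite_swap_wings\<close> the third argument may be either wing of the block.\<close>

definition wing :: "'a \<Rightarrow> 'a \<Rightarrow> 'a \<Rightarrow> bool" where
  "wing x y z \<longleftrightarrow> (\<exists>d. distinct [x,y,z,d] \<and> kite x y z d \<in> D)"

lemma cen_sym: "cen x y \<Longrightarrow> cen y x"
  unfolding cen_def using kite_swap_center by (metis distinct_length_2_or_more)

lemma cen_X:
  assumes "cen x y" shows "x \<in> X" "y \<in> X" "x \<noteq> y"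
proof -
  obtain c d where "kite x y c d \<in> D" using assms by (auto simp: cen_def)
  moreover have "{x,y} \<in> kite x y c d" by (simp add: kite_def)
  ultimately show "x \<in> X" "y \<in> X" "x \<noteq> y" using edge_X by blast+
qed

lemma cen_iff: "cen x y \<longleftrightarrow> (\<exists>B\<in>D. x \<in> centres B \<and> y \<in> centres B \<and> x \<noteq> y)"
proof
  assume "cen x y"
  then obtain c d where "distinct [x,y,c,d]" "kite x y c d \<in> D" by (auto simp: cen_def)
  then show "\<exists>B\<in>D. x \<in> centres B \<and> y \<in> centres B \<and> x \<noteq> y"
    by (intro bexI[of _ "kite x y c d"]) (auto simp: centres_kite)
next
  assume "\<exists>B\<in>D. x \<in> centres B \<and> y \<in> centres B \<and> x \<noteq> y"
  then obtain B where B: "B \<in> D" "x \<in> centres B" "y \<in> centres B" "x \<noteq> y" by blast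
  obtain a b c d where *: "distinct [a,b,c,d]" "B = kite a b c d" using blockE[OF B(1)] .
  have "(x = a \<and> y = b) \<or> (x = b \<and> y = a)" using B * by (auto simp: centres_kite)
  then show "cen x y"
    unfolding cen_def using * B(1) kite_swap_center by (metis distinct_length_2_or_more)
qed

text \<open>Each of the two blocks with centre \<open>x\<close> has one other centre. These differ,
  as a common one would put the edge to \<open>x\<close> into two blocks.\<close>

lemma card_cen:
  assumes "x \<in> X" shows "card {y. cen x y} = 2"
proof -
  let ?A = "{B\<in>D. x \<in> centres B}"
  have one: "card (centres B - {x}) = 1" "finite (centres B - {x})" if B: "B \<in> ?A" for B
  proof -
    obtain a b c d where "distinct [a,b,c,d]" "B = kite a b c d"
      using B by (blast elim: blockE)
    then show "card (centres B - {x}) = 1" "finite (centres B - {x})"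
      using B by (auto simp: centres_kite insert_Diff_if)
  qed
  have edge: "{x,y} \<in> B" if B: "B \<in> ?A" "y \<in> centres B - {x}" for B y
  proof -
    obtain a b c d where "distinct [a,b,c,d]" "B = kite a b c d"
      using B by (blast elim: blockE)
    then show ?thesis using B by (auto simp: centres_kite kite_mem)
  qed
  have "{y. cen x y} = (\<Union>B\<in>?A. centres B - {x})"
    by (auto simp: cen_iff)
  also have "card \<dots> = (\<Sum>B\<in>?A. card (centres B - {x}))"
  proof (rule card_UN_disjoint)
    show "finite ?A" using finite_D by simp
    show "\<forall>B\<in>?A. finite (centres B - {x})" using one by blast
    show "\<forall>B\<in>?A. \<forall>B'\<in>?A. B \<noteq> B' \<longrightarrow> (centres B - {x}) \<inter> (centres B' - {x}) = {}"
    proof (intro ballI impI)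
      fix B B' assume BB: "B \<in> ?A" "B' \<in> ?A" "B \<noteq> B'"
      show "(centres B - {x}) \<inter> (centres B' - {x}) = {}"
      proof (rule ccontr)
        assume "\<not> ?thesis"
        then obtain y where "y \<in> centres B - {x}" "y \<in> centres B' - {x}" by blast
        with edge BB block_unique[of B B' x y] show False by blast
      qed
    qed
  qed
  also have "\<dots> = (\<Sum>B\<in>?A. 1)" using one by (intro sum.cong) auto
  also have "\<dots> = 2" using two_centres[OF assms] by simp
  finally show ?thesis .
qed

lemma wingI: "distinct [x,b,y,d] \<Longrightarrow> kite x b y d \<in> D \<Longrightarrow> wing x b y"
  unfolding wing_def by blast

lemma wing_swap: "wing x b y \<Longrightarrow> wing b x y"
  unfolding wing_def using kite_swap_center by (metis distinct_length_2_or_more)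

text \<open>The block through \<open>{x,y}\<close> is unique and has a single central edge; the same
  reason gives \<open>wing_exclusive\<close>. These two facts produce the contradictions between
  covered pairs below.\<close>

lemma wing_unique:
  assumes "wing x b y" "wing x b' y" shows "b = b'"
proof -
  obtain d d' where *: "distinct [x,b,y,d]" "kite x b y d \<in> D" "distinct [x,b',y,d']" "kite x b' y d' \<in> D"
    using assms by (auto simp: wing_def)
  then have "kite x b y d = kite x b' y d'"
    by (intro block_unique[of _ _ x y]) (auto simp: kite_mem)
  then have "{x,b} = {x,b'}" by (rule kite_eqD(1)[OF *(1,3)])
  then show ?thesis by (auto simp: doubleton_eq_iff)
qed

lemma wing_exclusive:
  assumes "wing x b y" "wing y b' x" shows False
proof -
  obtain d d' where *: "distinct [x,b,y,d]" "kite x b y d \<in> D" "distinct [y,b',x,d']" "kite y b' x d' \<in> D"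
    using assms by (auto simp: wing_def)
  then have "kite x b y d = kite y b' x d'"
    by (intro block_unique[of _ _ x y]) (auto simp: kite_mem doubleton_eq_iff)
  then have "{x,b} = {y,b'}" by (rule kite_eqD(1)[OF *(1,3)])
  then show False using * by (auto simp: doubleton_eq_iff)
qed

lemma wing_cen: assumes "wing x b y" shows "cen x b" "\<not> cen x y"
proof -
  obtain d where d: "distinct [x,b,y,d]" "kite x b y d \<in> D" using assms by (auto simp: wing_def)
  then show "cen x b" by (auto simp: cen_def)
  show "\<not> cen x y"
  proof
    assume "cen x y"
    then obtain e f where *: "distinct [x,y,e,f]" "kite x y e f \<in> D" by (auto simp: cen_def)
    then have "kite x b y d = kite x y e f"
      using d by (intro block_unique[of _ _ x y]) (auto simp: kite_mem)
    then have "{x,b} = {x,y}" by (rule kite_eqD(1)[OF d(1) *(1)])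
    then show False using d by (auto simp: doubleton_eq_iff)
  qed
qed

text \<open>The four non-central edges of a block each join a centre to a wing.\<close>

lemma wing_exists:
  assumes "x \<in> X" "y \<in> X" "x \<noteq> y" "\<not> cen x y"
  shows "\<exists>b. wing x b y \<or> wing y b x"
proof -
  obtain B where B: "B \<in> D" "{x,y} \<in> B" using block_exists assms by blast
  obtain a b c d where *: "distinct [a,b,c,d]" "B = kite a b c d" using blockE[OF B(1)] .
  have "kite a b d c \<in> D" using * B(1) by (simp add: kite_swap_wings[of a b d c])
  then have "wing a b c" "wing a b d"
    using * B(1) wingI[of a b c d] wingI[of a b d c] by auto
  then have w: "wing a b c" "wing b a c" "wing a b d" "wing b a d"
    by (auto intro: wing_swap)
  have "cen a b" "cen b a" using w wing_cen(1) by blast+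
  then have "{x,y} \<noteq> {a,b}" using assms(4) by (auto simp: doubleton_eq_iff)
  then have "{x,y} = {a,c} \<or> {x,y} = {a,d} \<or> {x,y} = {b,c} \<or> {x,y} = {b,d}"
    using B(2) by (simp add: *(2) kite_mem)
  then show ?thesis using w by (auto simp: doubleton_eq_iff)
qed

lemma kite_of_wings:
  assumes "wing x b y" "wing x b z" "y \<noteq> z" shows "kite x b y z \<in> D"
proof -
  obtain d d' where *: "distinct [x,b,y,d]" "kite x b y d \<in> D" "distinct [x,b,z,d']" "kite x b z d' \<in> D"
    using assms by (auto simp: wing_def)
  then have "kite x b y d = kite x b z d'"
    by (intro block_unique[of _ _ x b]) (auto simp: kite_mem)
  then have "{y,d} = {z,d'}" by (rule kite_eqD(2)[OF *(1,3)])
  then have "d = z" using assms(3) by (auto simp: doubleton_eq_iff)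
  then show ?thesis using * by simp
qed

lemma triangles_disjoint:
  assumes "B \<in> D" "B' \<in> D" "S \<in> triangles B" "S \<in> triangles B'" shows "B = B'"
proof -
  obtain x y z where "S = {x,y,z}" "x \<noteq> y" using assms(3) by (auto simp: triangles_def card_3_iff)
  then have "{x,y} \<in> B" "{x,y} \<in> B'" using assms(3,4) by (auto simp: triangles_def)
  then show ?thesis using block_unique assms by blast
qed

lemma card_triangles: "B \<in> D \<Longrightarrow> card (triangles B) = 2" "B \<in> D \<Longrightarrow> finite (triangles B)"
  by (erule blockE, simp add: card_triangles_kite, erule blockE, simp add: triangles_kite)

lemma card_triangles_of_Int:
  "card (T \<inter> triangles_of D) = (\<Sum>B\<in>D. card (T \<inter> triangles B))"
proof -
  have "T \<inter> triangles_of D = (\<Union>B\<in>D. T \<inter> triangles B)" by (auto simp: triangles_of_def)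
  also have "card \<dots> = (\<Sum>B\<in>D. card (T \<inter> triangles B))"
    by (rule card_UN_disjoint) (use finite_D card_triangles triangles_disjoint in blast)+
  finally show ?thesis .
qed

text \<open>Both triangles contain the edge \<open>{a,b}\<close>, so they come from the same block
  of \<open>D\<close>. That block has no other triangles, and its two triangles determine
  it.\<close>

lemma triangles_determine_block:
  assumes "distinct [a,b,c,d]" "triangles (kite a b c d) \<subseteq> triangles_of D"
  shows "kite a b c d \<in> D"
proof -
  obtain B B' where B: "B \<in> D" "{a,b,c} \<in> triangles B" "B' \<in> D" "{a,b,d} \<in> triangles B'"
    using assms(2) by (auto simp: triangles_kite[OF assms(1)] triangles_of_def)
  have "{a,b} \<in> B" "{a,b} \<in> B'" using B assms(1) by (auto simp: triangles_def)
  then have "B' = B" using block_unique B by blast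
  then have "{{a,b,c},{a,b,d}} \<subseteq> triangles B" using B by auto
  moreover obtain a' b' c' d' where *: "distinct [a',b',c',d']" "B = kite a' b' c' d'" using blockE[OF B(1)] .
  moreover have "{a,b,c} \<noteq> {a,b,d}" using assms(1) by auto
  ultimately have "{{a,b,c},{a,b,d}} = {{a',b',c'},{a',b',d'}}"
    by (intro card_subset_eq) (auto simp: triangles_kite card_insert_if)
  then have "triangles (kite a b c d) = triangles (kite a' b' c' d')"
    by (simp only: triangles_kite[OF assms(1)] triangles_kite[OF *(1)])
  from triangles_kite_eqD[OF assms(1) *(1) this] have "kite a b c d = B"
    by (simp only: kite_eq_iff[OF assms(1) *(1)] *(2))
  then show ?thesis using B(1) by simp
qed

end

text \<open>A block that is not common to both designs contributes at most one common triangle.\<close>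
lemma common_triangles_le:
  assumes "design11 X D1" "design11 X D2"
  shows "card (triangles_of D1 \<inter> triangles_of D2) \<le> 11 + card (D1 \<inter> D2)"
proof -
  interpret D1: design11 X D1 by fact
  interpret D2: design11 X D2 by fact
  have "card (triangles_of D1 \<inter> triangles B) \<le> 1 + (if B \<in> D1 then 1 else 0)" if B: "B \<in> D2" for B
  proof (cases "B \<in> D1")
    case True
    have "card (triangles_of D1 \<inter> triangles B) \<le> card (triangles B)"
      using D2.card_triangles[OF B] by (intro card_mono) auto
    with True show ?thesis using D2.card_triangles[OF B] by simp
  next
    case False
    obtain a b c d where *: "distinct [a,b,c,d]" "B = kite a b c d" using D2.blockE[OF B] .
    have "\<not> triangles B \<subseteq> triangles_of D1"
      using D1.triangles_determine_block[OF *(1)] * False by blast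
    then have "triangles_of D1 \<inter> triangles B \<subset> triangles B" by blast
    then have "card (triangles_of D1 \<inter> triangles B) < 2"
      using psubset_card_mono D2.card_triangles[OF B] by metis
    with False show ?thesis by simp
  qed
  then have "(\<Sum>B\<in>D2. card (triangles_of D1 \<inter> triangles B)) \<le> (\<Sum>B\<in>D2. 1 + (if B \<in> D1 then 1 else 0))"
    by (rule sum_mono)
  also have "\<dots> = 11 + card (D1 \<inter> D2)"
    using D2.finite_D D2.card_D by (simp only: sum.distrib) (simp add: sum.If_cases Int_commute)
  finally show ?thesis by (simp add: D2.card_triangles_of_Int)
qed

subsection \<open>Cycles of the central graph\<close>

text \<open>A periodic function on all of \<open>nat\<close> replaces indices modulo
  \<open>l\<close>. Neighbours are stated at \<open>Suc i\<close>, so that the predecessor needs no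
  subtraction.\<close>

definition is_cycle :: "('a \<Rightarrow> 'a \<Rightarrow> bool) \<Rightarrow> nat \<Rightarrow> (nat \<Rightarrow> 'a) \<Rightarrow> bool" where
  "is_cycle R l p \<longleftrightarrow> 3 \<le> l \<and> inj_on p {..<l} \<and> (\<forall>i. p (i + l) = p i) \<and>
     (\<forall>i y. R (p (Suc i)) y \<longleftrightarrow> y = p i \<or> y = p (Suc (Suc i)))"

lemma mod_add_left_imp_eq:
  fixes i j k l :: nat
  assumes "(k + i) mod l = (k + j) mod l" shows "i mod l = j mod l"
proof (cases l)
  case (Suc m)
  \<comment> \<open>Adding (l - 1) * k turns the summand k into a multiple of \<open>l\<close>,
    which replaces subtraction in \<open>nat\<close>.\<close>
  have "(m * k + (k + i)) mod l = (m * k + (k + j)) mod l"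
    by (rule mod_add_cong[OF refl assms])
  moreover have "m * k + (k + i) = i + l * k" "m * k + (k + j) = j + l * k" by (simp_all add: Suc)
  ultimately have "(i + l * k) mod l = (j + l * k) mod l" by (simp only:)
  then show ?thesis by simp
qed (use assms in simp)

lemma is_cycle_mod:
  assumes "is_cycle R l p" shows "p i = p j \<longleftrightarrow> i mod l = j mod l"
proof -
  have "p (i + k * l) = p i" for i k
  proof (induction k)
    case (Suc k)
    have "p (i + Suc k * l) = p ((i + k * l) + l)" by (simp add: algebra_simps)
    then show ?case using Suc assms by (simp add: is_cycle_def)
  qed simp
  from this[of "i mod l" "i div l" for i] have *: "p i = p (i mod l)" for i by simp
  have "i mod l < l" "j mod l < l" using assms by (simp_all add: is_cycle_def)
  then show ?thesis
    using assms *[of i] *[of j] by (auto simp: is_cycle_def inj_on_def)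
qed

lemma is_cycle_range:
  assumes "is_cycle R l p" shows "range p = p ` {..<l}"
proof -
  have "p i \<in> p ` {..<l}" for i
    using is_cycle_mod[OF assms, of i "i mod l"] assms by (auto simp: is_cycle_def image_iff intro!: bexI[of _ "i mod l"])
  then show ?thesis by blast
qed

lemma is_cycle_card: "is_cycle R l p \<Longrightarrow> card (range p) = l"
  by (simp add: is_cycle_range card_image is_cycle_def)

lemma is_cycle_shift:
  assumes "is_cycle R l p" shows "is_cycle R l (\<lambda>i. p (i + k))"
proof -
  have "inj_on (\<lambda>i. p (i + k)) {..<l}"
  proof (rule inj_onI)
    fix x y assume "x \<in> {..<l}" "y \<in> {..<l}" "p (x + k) = p (y + k)"
    then show "x = y"
      using is_cycle_mod[OF assms] mod_add_left_imp_eq[of k x l y] by (simp add: add.commute)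
  qed
  moreover have "p (i + l + k) = p (i + k)" for i
  proof -
    have "i + l + k = (i + k) + l" by simp
    then show ?thesis using assms by (simp only: is_cycle_def)
  qed
  ultimately show ?thesis using assms by (simp add: is_cycle_def)
qed

text \<open>Multiplication by l - 1 is negation modulo \<open>l\<close>, so this is the same cycle
  traversed backwards.\<close>

lemma is_cycle_reflect:
  assumes "is_cycle R l p" shows "is_cycle R l (\<lambda>i. p ((l - 1) * i))"
proof -
  have l: "3 \<le> l" using assms by (simp add: is_cycle_def)
  note m = is_cycle_mod[OF assms]
  have inj: "inj_on (\<lambda>i. p ((l - 1) * i)) {..<l}"
  proof (rule inj_onI)
    fix x y assume xy: "x \<in> {..<l}" "y \<in> {..<l}" "p ((l - 1) * x) = p ((l - 1) * y)"
    then have "((l - 1) * x + (x + y)) mod l = ((l - 1) * y + (x + y)) mod l"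
      unfolding m by (blast intro: mod_add_cong)
    moreover have "(l - 1) * x + (x + y) = y + l * x" "(l - 1) * y + (x + y) = x + l * y"
      using l by (cases l; simp)+
    ultimately have "(y + l * x) mod l = (x + l * y) mod l" by (simp only:)
    then show "x = y" using xy by simp
  qed
  have per: "p ((l - 1) * (i + l)) = p ((l - 1) * i)" for i
    unfolding m by (simp add: add_mult_distrib2)
  have "R (p ((l - 1) * Suc i)) y \<longleftrightarrow> y = p ((l - 1) * i) \<or> y = p ((l - 1) * Suc (Suc i))" for i y
  proof -
    \<comment> \<open>\<open>Suc n\<close> is the position of the reflected index i + 1; its
      predecessor \<open>n\<close> is the reflected i + 2, up to a period.\<close>
    define n where "n = (l - 1) * i + (l - 2)"
    have n: "(l - 1) * Suc i = Suc n" using l by (simp add: n_def)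
    have "Suc (Suc n) = (l - 1) * i + l" using l by (simp add: n_def)
    then have "p ((l - 1) * i) = p (Suc (Suc n))" unfolding m by simp
    moreover have "(l - 1) * Suc (Suc i) = n + l" using l by (simp add: n_def)
    then have "p ((l - 1) * Suc (Suc i)) = p n" unfolding m by simp
    ultimately show ?thesis using assms unfolding n is_cycle_def by metis
  qed
  with l inj per show ?thesis by (simp add: is_cycle_def)
qed

text \<open>A walk that never turns back closes up at its starting point, since every other vertex already
  has both of its neighbours on the walk.\<close>
lemma two_regular_has_cycle:
  assumes fin: "finite S" and x0: "x0 \<in> S"
    and sym: "\<And>x y. R x y \<Longrightarrow> R y x" and irr: "\<And>x. \<not> R x x"
    and two: "\<And>x. x \<in> S \<Longrightarrow> card {y. R x y} = 2"
    and closed: "\<And>x y. x \<in> S \<Longrightarrow> R x y \<Longrightarrow> y \<in> S"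
  obtains l p where "is_cycle R l p" "range p \<subseteq> S"
proof -
  have other: "\<exists>z. z \<noteq> x \<and> R y z \<and> (\<forall>u. R y u \<longrightarrow> u = x \<or> u = z)" if y: "y \<in> S" "R x y" for x y
  proof -
    obtain a b where ab: "{u. R y u} = {a,b}" "a \<noteq> b" using two[OF y(1)] by (auto simp: card_2_iff)
    then have *: "R y u \<longleftrightarrow> u = a \<or> u = b" for u by blast
    then have "x = a \<or> x = b" using sym[OF y(2)] by blast
    then show ?thesis using ab(2) * by metis
  qed
  define nxt where "nxt x y = (SOME z. z \<noteq> x \<and> R y z \<and> (\<forall>u. R y u \<longrightarrow> u = x \<or> u = z))" for x y
  have nxt: "nxt x y \<noteq> x" "R y (nxt x y)" "R y u \<Longrightarrow> u = x \<or> u = nxt x y" if "y \<in> S" "R x y" for x y u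
    using someI_ex[OF other[OF that]] unfolding nxt_def[symmetric] by blast+
  obtain x1 where x1: "R x0 x1" using two[OF x0] by (auto simp: card_2_iff)
  \<comment> \<open>The state is a pair of consecutive vertices, because the next vertex depends on
    where the walk came from.\<close>
  define w where "w = rec_nat (x0, x1) (\<lambda>_ (x,y). (y, nxt x y))"
  define p where "p i = fst (w i)" for i
  have w0: "w 0 = (x0, x1)" and wS: "w (Suc i) = (snd (w i), nxt (fst (w i)) (snd (w i)))" for i
    by (simp_all add: w_def case_prod_beta)
  have p0: "p 0 = x0" "p (Suc 0) = x1" and pS: "p (Suc (Suc i)) = nxt (p i) (p (Suc i))" for i
    by (simp_all add: p_def w0 wS)
  have pR: "p i \<in> S \<and> R (p i) (p (Suc i))" for i
  proof (induction i)
    case 0 then show ?case using x0 x1 by (simp add: p0)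
  next
    case (Suc i)
    then have "p (Suc i) \<in> S" using closed by blast
    with Suc show ?case using nxt(2) by (simp add: pS)
  qed
  have nbr: "R (p (Suc i)) y \<longleftrightarrow> y = p i \<or> y = p (Suc (Suc i))" for i y
    using pR[of i] pR[of "Suc i"] nxt(3)[of "p (Suc i)" "p i"] sym unfolding pS by metis
  have turn: "p (Suc (Suc i)) \<noteq> p i" for i using pR[of i] pR[of "Suc i"] nxt(1) by (simp add: pS)
  have "\<not> inj p"
    using fin pR finite_imageD[of p UNIV] finite_subset[of "range p" S] by (auto simp: image_subset_iff)
  then obtain i j where "i < j" "p i = p j" by (metis injI linorder_neqE_nat)
  then have ex: "\<exists>l. \<exists>k<l. p k = p l" by blast
  define l where "l = (LEAST l. \<exists>k<l. p k = p l)"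
  obtain k where k: "k < l" "p k = p l" using LeastI_ex[OF ex] unfolding l_def by blast
  have inj: "inj_on p {..<l}"
  proof (rule linorder_inj_onI)
    fix x y assume "x < y" "x \<in> {..<l}" "y \<in> {..<l}"
    then show "p x \<noteq> p y" using not_less_Least[of y "\<lambda>l. \<exists>k<l. p k = p l"] unfolding l_def by auto
  qed auto
  have l1: "l \<noteq> Suc k" using pR[of k] irr k(2) by auto
  have l2: "l \<noteq> Suc (Suc k)" using turn k(2) by metis
  obtain m where m: "l = Suc m" using k(1) by (cases l) auto
  have Rm: "R (p l) (p m)" using pR[of m] sym by (simp add: m)
  \<comment> \<open>If \<open>k\<close> were positive, \<open>p m\<close> would be one of the two
    neighbours of \<open>p k\<close> already on the walk, which repeats a vertex before index
    \<open>l\<close>.\<close>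
  have "k = 0"
  proof (cases k)
    case (Suc i)
    then have "R (p (Suc i)) (p m)" using Rm k(2) by simp
    then have "p m = p i \<or> p m = p (Suc (Suc i))" by (simp add: nbr)
    then have "m = i \<or> m = Suc (Suc i)"
      using inj_onD[OF inj, of m i] inj_onD[OF inj, of m "Suc (Suc i)"] l1 l2 k(1) Suc m by auto
    then show ?thesis using l2 Suc m k(1) l1 by auto
  qed
  then have pl: "p l = p 0" using k by simp
  have l3: "3 \<le> l" using l1 l2 k(1) \<open>k = 0\<close> by linarith
  have "p m \<noteq> p 1" using inj_onD[OF inj, of m 1] l3 m by auto
  have "p (Suc m) = p 0" using pl m by simp
  \<comment> \<open>\<open>p 1\<close> is a neighbour of \<open>p 0 = p l\<close>, and those
    neighbours are the vertices just before and just after index \<open>l\<close>. The former is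
    excluded, so the walk continues as it started.\<close>
  have "p 1 = p m \<or> p 1 = p (Suc (Suc m))"
    using pR[of 0] nbr[of m "p 1"] \<open>p (Suc m) = p 0\<close> by simp
  then have "p (Suc l) = p (Suc 0)" using \<open>p m \<noteq> p 1\<close> m by simp
  have "p (i + l) = p i \<and> p (Suc i + l) = p (Suc i)" for i
    by (induction i) (simp_all add: pl \<open>p (Suc l) = p (Suc 0)\<close> pS)
  then have "is_cycle R l p" using l3 inj nbr by (simp add: is_cycle_def)
  moreover have "range p \<subseteq> S" using pR by blast
  ultimately show thesis by (rule that)
qed

text \<open>\<open>a (Suc i)\<close> excludes \<open>b (Suc i)\<close> and thus forces \<open>a i\<close>; periodicity carries this around the cycle.\<close>
lemma periodic_dichotomy:
  fixes a b :: "nat \<Rightarrow> bool"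
  assumes "0 < l" and per: "\<And>i. a (i + l) = a i" "\<And>i. b (i + l) = b i"
    and or: "\<And>i. a i \<or> b (Suc i)" and ex: "\<And>i. \<not> (a i \<and> b i)"
  shows "(\<forall>i. a i) \<or> (\<forall>i. b i)"
proof (cases "\<exists>i. a i")
  case True
  then obtain i where i: "a i" by blast
  have step: "a (Suc j) \<Longrightarrow> a j" for j using or ex by blast
  have down: "a (j + k) \<Longrightarrow> a j" for j k by (induction k) (auto dest: step)
  have "a (i + j * l)" for j
  proof (induction j)
    case (Suc j)
    then show ?case using per(1)[of "i + j * l"] by (simp add: algebra_simps)
  qed (simp add: i)
  moreover have "i + j * l = j + (i + j * (l - 1))" for j using \<open>0 < l\<close> by (cases l) simp_all
  ultimately have "a j" for j using down[of j "i + j * (l - 1)"] by metis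
  then show ?thesis by blast
next
  case False
  then have "b (Suc i)" for i using or by blast
  then have "b (i + l)" for i using \<open>0 < l\<close> by (cases l) simp_all
  then show ?thesis using per by blast
qed

section \<open>Propagation of covering choices around a central cycle\<close>

context design11 begin

abbreviation "cyc l p \<equiv> is_cycle cen l p \<and> range p \<subseteq> X"

lemma cyc_period: "cyc l p \<Longrightarrow> p (i + l) = p i"
  by (simp add: is_cycle_def)

lemma cyc_neq: "cyc l p \<Longrightarrow> i < l \<Longrightarrow> j < l \<Longrightarrow> i \<noteq> j \<Longrightarrow> p i \<noteq> p j"
  by (auto simp: is_cycle_def inj_on_def)

lemma cyc_cen: "cyc l p \<Longrightarrow> 0 < k \<Longrightarrow> cen (p k) y \<longleftrightarrow> y = p (k - 1) \<or> y = p (k + 1)"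
  by (cases k) (auto simp: is_cycle_def)

lemma cyc_wing: "cyc l p \<Longrightarrow> 0 < k \<Longrightarrow> wing (p k) b y \<Longrightarrow> b = p (k - 1) \<or> b = p (k + 1)"
  using wing_cen(1)[of "p k" b y] cyc_cen[of l p k b] by simp

lemma cyc_shift: "cyc l p \<Longrightarrow> cyc l (\<lambda>i. p (i + k))"
  using is_cycle_shift by blast

text \<open>The bounds keep \<open>p j\<close> and \<open>p k\<close> from being adjacent, also
  across the end of the period. The block of the pair then has one of them as centre, and its
  central edge leads to a cycle neighbour of that vertex.\<close>

lemma cyc_pair:
  assumes c: "cyc l p" and jk: "0 < j" "j < l" "0 < k" "k < l" "j + 1 < k"
  shows "wing (p j) (p (j - 1)) (p k) \<or> wing (p j) (p (j + 1)) (p k) \<or>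
    wing (p k) (p (k - 1)) (p j) \<or> wing (p k) (p (k + 1)) (p j)"
proof -
  have "p j \<noteq> p k" "p (j - 1) \<noteq> p k" "p (j + 1) \<noteq> p k"
    using cyc_neq[OF c] jk by auto
  then have "\<not> cen (p j) (p k)" using cyc_cen[OF c jk(1)] by auto
  then obtain b where "wing (p j) b (p k) \<or> wing (p k) b (p j)"
    using wing_exists c \<open>p j \<noteq> p k\<close> by blast
  then show ?thesis
    using cyc_wing[OF c jk(1), of b "p k"] cyc_wing[OF c jk(3), of b "p j"] by metis
qed

text \<open>The options whose central edge uses the middle vertex \<open>p (i + 2)\<close> fail,
  because that vertex has central edges to both ends of the pair.\<close>

lemma distance_two:
  assumes c: "cyc l p" and l: "4 \<le> l"
  shows "wing (p i) (p (i + 1)) (p (i + 3)) \<or> wing (p (i + 3)) (p (i + 4)) (p (i + 1))"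
proof -
  have *: "wing (p 0) (p 1) (p 3) \<or> wing (p 3) (p 4) (p 1)" if c: "cyc l p" for p
  proof -
    have "\<not> wing (p 1) (p 2) (p 3)"
      using wing_cen(2)[of "p 2" "p 1" "p 3"] wing_swap cyc_cen[OF c, of 2] by auto
    moreover have "\<not> wing (p 3) (p 2) (p 1)"
      using wing_cen(2)[of "p 2" "p 3" "p 1"] wing_swap cyc_cen[OF c, of 2] by auto
    ultimately show ?thesis
      using cyc_pair[OF c, of 1 3] l wing_swap[of "p 1" "p 0" "p 3"] by (auto simp: numeral_2_eq_2)
  qed
  show ?thesis using *[OF cyc_shift[OF c, of i]] by (simp add: add.commute)
qed

text \<open>\<open>?a i\<close> and \<open>?b i\<close> both cover the pair of positions i and i +
  3, with opposite centres, hence exclude each other. If \<open>?b\<close> holds throughout,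
  reversing the cycle turns it into \<open>?a\<close>.\<close>

lemma three_wings:
  assumes c: "cyc l p" and l: "4 \<le> l"
  obtains q where "cyc l q" "\<And>i. wing (q i) (q (i + 1)) (q (i + 3))"
proof -
  let ?a = "\<lambda>i. wing (p i) (p (i + 1)) (p (i + 3))" and ?b = "\<lambda>i. wing (p (i + 2)) (p (i + 3)) (p i)"
  have per: "p (i + k + l) = p (i + k)" for i k using cyc_period[OF c] .
  have "(\<forall>i. ?a i) \<or> (\<forall>i. ?b i)"
  proof (rule periodic_dichotomy[of l])
    show "?a (i + l) = ?a i" "?b (i + l) = ?b i" for i
      using per[of i 0] per[of i 1] per[of i 2] per[of i 3] by (simp_all add: ac_simps)
    show "?a i \<or> ?b (Suc i)" for i
      using distance_two[OF assms, of i] by (simp add: numeral_eq_Suc)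
    show "\<not> (?a i \<and> ?b i)" for i using wing_exclusive wing_swap by blast
  qed (use l in simp)
  then show thesis
  proof
    assume "\<forall>i. ?a i" then show thesis using that c by blast
  next
    assume b: "\<forall>i. ?b i"
    let ?q = "\<lambda>i. p ((l - 1) * i)"
    have q: "cyc l ?q" using is_cycle_reflect c by blast
    have "wing (?q i) (?q (i + 1)) (?q (i + 3))" for i
    proof -
      \<comment> \<open>Modulo \<open>l\<close>, the reflected indices i, i + 1, i + 3 are m + 3, m
        + 2, m, the pattern of \<open>?b m\<close> with its centres swapped.\<close>
      define m where "m = (l - 1) * i + (l - 3)"
      have e: "(l - 1) * i + l = m + 3" "(l - 1) * (i + 1) = m + 2" "(l - 1) * (i + 3) = m + l + l"
        using l by (simp_all add: m_def add_mult_distrib2)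
      have "?q i = p (m + 3)" using cyc_period[OF c, of "(l - 1) * i"] e by simp
      moreover have "?q (i + 1) = p (m + 2)" using e by simp
      moreover have "?q (i + 3) = p m" using cyc_period[OF c] e by simp
      ultimately show ?thesis using b wing_swap by simp
    qed
    then show thesis using that q by blast
  qed
qed

text \<open>The pair of positions 0 and 3 is covered with \<open>q 0\<close> as centre. For length 4
  it is a central edge; for lengths 5 and 6 another translate covers it with \<open>q 3\<close> as
  centre. For length 8 all four options for the pair of positions 1 and 5 collide with
  translates.\<close>

lemma excluded_cycles:
  assumes c: "cyc l p" shows "l \<notin> {4,5,6,8}"
proof
  assume l: "l \<in> {4,5,6,8}"
  then have "4 \<le> l" by auto
  then obtain q where q: "cyc l q" and a: "\<And>i. wing (q i) (q (i + 1)) (q (i + 3))"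
    using three_wings[OF c] by blast
  note per = cyc_period[OF q]
  consider "l = 4" | "l = 5" | "l = 6" | "l = 8" using l by auto
  then show False
  proof cases
    case 1
    have "cen (q 4) (q 3)" using cyc_cen[OF q, of 4] by simp
    then have "cen (q 0) (q 3)" using per[of 0] 1 by simp
    then show False using a[of 0] wing_cen(2) by simp
  next
    case 2
    have "wing (q 2) (q 3) (q 0)" using a[of 2] per[of 0] 2 by simp
    then show False using a[of 0] wing_exclusive[of "q 0" "q 1" "q 3" "q 2"] wing_swap by simp
  next
    case 3
    have "wing (q 3) (q 4) (q 0)" using a[of 3] per[of 0] 3 by simp
    then show False using a[of 0] wing_exclusive[of "q 0" "q 1" "q 3" "q 4"] by simp
  next
    case 4
    have "wing (q 1) (q 0) (q 5) \<or> wing (q 1) (q 2) (q 5) \<or> wing (q 5) (q 4) (q 1) \<or> wing (q 5) (q 6) (q 1)"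
      using cyc_pair[OF q, of 1 5] 4 by (simp add: numeral_2_eq_2)
    then show False
    proof (elim disjE)
      assume "wing (q 1) (q 0) (q 5)"
      moreover have "wing (q 5) (q 6) (q 0)" using a[of 5] per[of 0] 4 by simp
      ultimately show False using wing_exclusive wing_swap by blast
    next
      assume "wing (q 1) (q 2) (q 5)"
      then have "q 1 = q 3" using a[of 2] wing_unique[of "q 2" "q 1" "q 5" "q 3"] wing_swap by simp
      then show False using cyc_neq[OF q, of 1 3] 4 by simp
    next
      assume "wing (q 5) (q 4) (q 1)"
      then show False using a[of 1] wing_exclusive[of "q 4" "q 5" "q 1" "q 2"] wing_swap by (simp add: numeral_2_eq_2)
    next
      assume "wing (q 5) (q 6) (q 1)"
      moreover have "wing (q 6) (q 7) (q 1)" using a[of 6] per[of 1] 4 by simp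
      ultimately have "q 5 = q 7" using wing_unique wing_swap by blast
      then show False using cyc_neq[OF q, of 5 7] 4 by simp
    qed
  qed
qed

section \<open>Decomposition of the vertex set into central cycles\<close>

definition closed :: "'a set \<Rightarrow> bool" where
  "closed S \<longleftrightarrow> S \<subseteq> X \<and> (\<forall>x\<in>S. \<forall>y. cen x y \<longrightarrow> y \<in> S)"

lemma closed_cycle:
  assumes S: "closed S" "0 < card S"
  obtains l p where "cyc l p" "l \<in> {3,7,9,10,11}" "l \<le> card S"
    "closed (S - range p)" "card (S - range p) = card S - l"
proof -
  have fin: "finite S" and "S \<noteq> {}" using S(2) by (auto intro: card_ge_0_finite)
  then obtain x0 where "x0 \<in> S" by blast
  from fin this obtain l p where p: "is_cycle cen l p" "range p \<subseteq> S"
  proof (rule two_regular_has_cycle[where R = cen])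
    show "cen x y \<Longrightarrow> cen y x" for x y by (rule cen_sym)
    show "\<not> cen x x" for x using cen_X(3) by blast
    show "x \<in> S \<Longrightarrow> card {y. cen x y} = 2" for x using S card_cen by (auto simp: closed_def)
    show "x \<in> S \<Longrightarrow> cen x y \<Longrightarrow> y \<in> S" for x y using S by (auto simp: closed_def)
  qed
  have c: "cyc l p" using p S by (auto simp: closed_def)
  have card: "card (range p) = l" by (rule is_cycle_card[OF p(1)])
  have le: "l \<le> card S" using card_mono[OF fin p(2)] card by simp
  also have "\<dots> \<le> 11" using card_mono[OF finite_X, of S] S card_X by (simp add: closed_def)
  finally have "l \<in> {3,4,5,6,7,8,9,10,11}" using p(1) by (auto simp: is_cycle_def)
  then have "l \<in> {3,7,9,10,11}" using excluded_cycles[OF c] by auto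
  moreover have "closed (S - range p)"
    unfolding closed_def
  proof (intro conjI ballI allI impI)
    show "S - range p \<subseteq> X" using S by (auto simp: closed_def)
    fix x y assume x: "x \<in> S - range p" and xy: "cen x y"
    have "y \<notin> range p"
    proof
      assume "y \<in> range p"
      then obtain i where "y = p i" by blast
      \<comment> \<open>The index is raised by a full period so that it has a predecessor even for i
        = 0.\<close>
      also have "\<dots> = p (Suc (i + l - 1))" using cyc_period[OF c, of i] p(1) by (simp add: is_cycle_def)
      finally have "cen (p (Suc (i + l - 1))) x" using cen_sym[OF xy] by simp
      then have "x = p (i + l - 1) \<or> x = p (Suc (Suc (i + l - 1)))"
        using p(1) unfolding is_cycle_def by blast
      then have "x \<in> range p" by blast
      then show False using x by blast
    qed
    then show "y \<in> S - range p" using x xy S by (auto simp: closed_def)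
  qed
  moreover have "card (S - range p) = card S - l"
    using p(2) card fin by (simp add: card_Diff_subset finite_subset)
  ultimately show thesis using that c le by blast
qed

text \<open>Removing cycles of the allowed lengths leads from 8 to 5 or 1, from 5 to 2 and from 4 to
  1, while 1 and 2 are shorter than any cycle. Together with 0, these cover every remainder that a
  first cycle can leave among 11 vertices.\<close>

lemma no_small_closed:
  assumes "closed S" "card S \<in> {1,2,4,5,8}" shows False
proof -
  have step: "\<exists>S' l. closed S' \<and> l \<in> {3,7,9,10,11} \<and> l \<le> card S \<and> card S' = card S - l"
    if "closed S" "0 < card S" for S
    using closed_cycle[OF that] by metis
  have 12: False if "closed S" "card S \<in> {1,2}" for S using step[OF that(1)] that(2) by auto
  have 4: False if "closed S" "card S = 4" for S
    using step[OF that(1)] that(2) 12 by fastforce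
  have 5: False if "closed S" "card S = 5" for S
    using step[OF that(1)] that(2) 12 by fastforce
  have 8: False if "closed S" "card S = 8" for S
    using step[OF that(1)] that(2) 12 5 by fastforce
  show False using assms 12 4 5 8 by auto
qed

lemma central_hamiltonian_cycle:
  obtains p where "cyc 11 p"
proof -
  have "closed X" using cen_X by (auto simp: closed_def)
  moreover have "0 < card X" by (simp add: card_X)
  ultimately obtain l p where p: "cyc l p" "l \<in> {3,7,9,10,11}" "l \<le> card X"
    "closed (X - range p)" "card (X - range p) = card X - l"
    by (rule closed_cycle)
  then have "l = 11" using no_small_closed[OF p(4)] by (auto simp: card_X)
  then show thesis using that p by blast
qed

text \<open>For positions 1 and 5, \<open>p 2\<close> and \<open>p 4\<close> cannot complete the
  central edge: the pairs of positions 2, 5 and 1, 4 are already covered by the wings at offset 3.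
  The dichotomy then fixes the second wing of every block.\<close>

lemma two_designs:
  obtains p w where "cyc 11 p" "w \<in> {5,7}" "\<And>i. kite (p i) (p (i + 1)) (p (i + 3)) (p (i + w)) \<in> D"
proof -
  obtain p0 where "cyc 11 p0" by (rule central_hamiltonian_cycle)
  then obtain p where c: "cyc 11 p" and a: "\<And>i. wing (p i) (p (i + 1)) (p (i + 3))"
    using three_wings[of 11] by auto
  let ?c = "\<lambda>i. wing (p i) (p (i + 1)) (p (i + 5))" and ?d = "\<lambda>i. wing (p (i + 4)) (p (i + 5)) (p i)"
  have per: "p (i + k + 11) = p (i + k)" for i k using cyc_period[OF c] .
  have dist4: "wing (p 0) (p 1) (p 5) \<or> wing (p 5) (p 6) (p 1)"
    if c: "cyc 11 p" and a: "\<And>i. wing (p i) (p (i + 1)) (p (i + 3))" for p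
  proof -
    have "p 1 \<noteq> p 3" using cyc_neq[OF c, of 1 3] by simp
    then have "\<not> wing (p 1) (p 2) (p 5)"
      using a[of 2] wing_unique[of "p 2" "p 1" "p 5" "p 3"] wing_swap[of "p 1" "p 2" "p 5"] by auto
    moreover have "\<not> wing (p 5) (p 4) (p 1)"
      using a[of 1] wing_exclusive[of "p 4" "p 5" "p 1" "p 2"] wing_swap[of "p 5" "p 4" "p 1"]
      by (auto simp: numeral_2_eq_2)
    ultimately show ?thesis
      using cyc_pair[OF c, of 1 5] wing_swap[of "p 1" "p 0" "p 5"] by (auto simp: numeral_2_eq_2)
  qed
  have "(\<forall>i. ?c i) \<or> (\<forall>i. ?d i)"
  proof (rule periodic_dichotomy[of 11])
    show "?c (i + 11) = ?c i" "?d (i + 11) = ?d i" for i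
      using per[of i 0] per[of i 1] per[of i 4] per[of i 5] by (simp_all add: ac_simps)
    show "?c i \<or> ?d (Suc i)" for i
      using dist4[OF cyc_shift[OF c, of i]] a by (simp add: numeral_eq_Suc)
    show "\<not> (?c i \<and> ?d i)" for i using wing_exclusive wing_swap by blast
  qed simp
  then obtain w where w: "w \<in> {5,7}" "\<And>i. wing (p i) (p (i + 1)) (p (i + w))"
  proof
    assume "\<forall>i. ?c i" then show thesis using that[of 5] by simp
  next
    assume d: "\<forall>i. ?d i"
    \<comment> \<open>The wing lies four steps before the central edge, and -4 is 7 modulo
      11.\<close>
    have "wing (p i) (p (i + 1)) (p (i + 7))" for i
    proof -
      have "p i = p (i + 7 + 4)" "p (i + 1) = p (i + 7 + 5)"
        using cyc_period[OF c, of i] cyc_period[OF c, of "i + 1"] by (simp_all add: ac_simps)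
      then show ?thesis using d by metis
    qed
    then show thesis using that[of 7] by simp
  qed
  have "p (i + 3) \<noteq> p (i + w)" for i
    using cyc_neq[OF cyc_shift[OF c, of i], of 3 w] w(1) by (auto simp: add.commute)
  then have "kite (p i) (p (i + 1)) (p (i + 3)) (p (i + w)) \<in> D" for i
    using kite_of_wings a w(2) by blast
  then show thesis using that c w(1) by blast
qed

end

subsection \<open>The two cyclic designs and the search\<close>

datatype z11 = V0 | V1 | V2 | V3 | V4 | V5 | V6 | V7 | V8 | V9 | V10

definition vertices :: "z11 list" where "vertices = [V0,V1,V2,V3,V4,V5,V6,V7,V8,V9,V10]"

lemma set_vertices: "set vertices = UNIV"
proof -
  have "x \<in> set vertices" for x by (cases x) (simp_all add: vertices_def)
  then show ?thesis by blast
qed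

lemma distinct_vertices: "distinct vertices" by (simp add: vertices_def)

lemma length_vertices: "length vertices = 11" by (simp add: vertices_def)

lemma card_z11: "card (UNIV :: z11 set) = 11"
  by (simp only: set_vertices[symmetric] distinct_card[OF distinct_vertices] length_vertices)

lemma finite_z11: "finite (A :: z11 set)"
  using finite_subset[OF subset_UNIV] finite_set[of vertices] unfolding set_vertices by blast

fun nx :: "z11 \<Rightarrow> z11" where
  "nx V0 = V1" | "nx V1 = V2" | "nx V2 = V3" | "nx V3 = V4" | "nx V4 = V5"
| "nx V5 = V6" | "nx V6 = V7" | "nx V7 = V8" | "nx V8 = V9" | "nx V9 = V10"
| "nx V10 = V0"

text \<open>The third and fourth vertex of the base block at a vertex; the flag selects the design
  with base block \<open>[0,1,3-5]\<close> or \<open>[0,1,3-7]\<close> modulo 11.\<close>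
fun n3 :: "z11 \<Rightarrow> z11" where
  "n3 V0 = V3" | "n3 V1 = V4" | "n3 V2 = V5" | "n3 V3 = V6" | "n3 V4 = V7"
| "n3 V5 = V8" | "n3 V6 = V9" | "n3 V7 = V10" | "n3 V8 = V0" | "n3 V9 = V1"
| "n3 V10 = V2"

fun nw :: "bool \<Rightarrow> z11 \<Rightarrow> z11" where
  "nw True V0 = V5" | "nw True V1 = V6" | "nw True V2 = V7" | "nw True V3 = V8" | "nw True V4 = V9"
| "nw True V5 = V10" | "nw True V6 = V0" | "nw True V7 = V1" | "nw True V8 = V2" | "nw True V9 = V3"
| "nw True V10 = V4" | "nw False V0 = V7" | "nw False V1 = V8" | "nw False V2 = V9" | "nw False V3 = V10"
| "nw False V4 = V0" | "nw False V5 = V1" | "nw False V6 = V2" | "nw False V7 = V3" | "nw False V8 = V4"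
| "nw False V9 = V5" | "nw False V10 = V6"

lemma inj_nx: "inj nx"
proof (rule injI)
  fix x y assume "nx x = nx y" then show "x = y" by (cases x; cases y) simp_all
qed

lemma n3_funpow: "n3 x = (nx ^^ 3) x" by (cases x) (simp_all add: numeral_eq_Suc)
lemma nw_funpow: "nw w x = (nx ^^ (if w then 5 else 7)) x"
  by (cases x; cases w) (simp_all add: numeral_eq_Suc)

text \<open>Conditionals instead of connectives, because the simplifier evaluates only these lazily.\<close>
definition is_cyc_block :: "bool \<Rightarrow> z11 \<Rightarrow> z11 \<Rightarrow> z11 \<Rightarrow> z11 \<Rightarrow> bool" where
  "is_cyc_block w a b c d =
    (if b = nx a then if c = n3 a then d = nw w a else if d = n3 a then c = nw w a else False
     else if a = nx b then if c = n3 b then d = nw w b else if d = n3 b then c = nw w b else False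
     else False)"

text \<open>\<open>{a,b}\<close> is the candidate central edge and \<open>c\<close> the apex;
  \<open>is_cyc_triangle\<close> tries each vertex as apex.\<close>

definition is_arc_triangle :: "bool \<Rightarrow> z11 \<Rightarrow> z11 \<Rightarrow> z11 \<Rightarrow> bool" where
  "is_arc_triangle w a b c =
    (if b = nx a then if c = n3 a then True else c = nw w a
     else if a = nx b then if c = n3 b then True else c = nw w b
     else False)"

definition is_cyc_triangle :: "bool \<Rightarrow> z11 \<Rightarrow> z11 \<Rightarrow> z11 \<Rightarrow> bool" where
  "is_cyc_triangle w a b c = (if is_arc_triangle w a b c then True else if is_arc_triangle w a c b then True else is_arc_triangle w b c a)"

text \<open>\<open>f\<close> carries labels of the second cycle, of type \<open>w'\<close>, to
  labels of the first, of type \<open>w\<close>.\<close>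

definition common_block_at :: "bool \<Rightarrow> bool \<Rightarrow> (z11 \<Rightarrow> z11) \<Rightarrow> z11 \<Rightarrow> bool" where
  "common_block_at w w' f e = is_cyc_block w (f e) (f (nx e)) (f (n3 e)) (f (nw w' e))"

primrec common_blocks :: "bool \<Rightarrow> bool \<Rightarrow> (z11 \<Rightarrow> z11) \<Rightarrow> z11 list \<Rightarrow> nat" where
  "common_blocks w w' f [] = 0"
| "common_blocks w w' f (e # es) = (if common_block_at w w' f e then Suc (common_blocks w w' f es) else common_blocks w w' f es)"

primrec common_triangles :: "bool \<Rightarrow> bool \<Rightarrow> (z11 \<Rightarrow> z11) \<Rightarrow> z11 list \<Rightarrow> nat" where
  "common_triangles w w' f [] = 0"
| "common_triangles w w' f (e # es) =
    (if is_cyc_triangle w (f e) (f (nx e)) (f (n3 e)) then 1 else 0) +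
    (if is_cyc_triangle w (f e) (f (nx e)) (f (nw w' e)) then 1 else 0) + common_triangles w w' f es"

lemma common_blocks_card: "distinct es \<Longrightarrow> common_blocks w w' f es = card {e \<in> set es. common_block_at w w' f e}"
proof (induction es)
  case (Cons e es)
  have "{x \<in> set (e # es). common_block_at w w' f x} =
      (if common_block_at w w' f e then insert e {x \<in> set es. common_block_at w w' f x} else {x \<in> set es. common_block_at w w' f x})"
    by auto
  then show ?case using Cons by simp
qed simp

lemma common_triangles_sum: "distinct es \<Longrightarrow> common_triangles w w' f es = (\<Sum>e\<in>set es.
    (if is_cyc_triangle w (f e) (f (nx e)) (f (n3 e)) then 1 else 0) +
    (if is_cyc_triangle w (f e) (f (nx e)) (f (nw w' e)) then 1 else 0))"
  by (induction es) simp_all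

text \<open>Otherwise each of the eleven windows of four consecutive vertices holds at most one marked
  vertex, so that \<open>4 * 3 \<le> 11\<close>.\<close>
lemma close_pair:
  assumes "3 \<le> card {e. P e}"
  obtains e d where "d \<in> {V1,V2,V3}" "P e" "d = V1 \<Longrightarrow> P (nx e)" "d = V2 \<Longrightarrow> P (nx (nx e))" "d = V3 \<Longrightarrow> P (n3 e)"
proof -
  have "\<exists>e. P e \<and> (P (nx e) \<or> P (nx (nx e)) \<or> P (n3 e))"
  proof (rule ccontr)
    assume no: "\<not> ?thesis"
    define z where "z e = (if P e then 1 else 0 :: nat)" for e
    have win: "z e + z (nx e) + z (nx (nx e)) + z (n3 e) \<le> 1" for e
    proof -
      have *: "n3 e = nx (nx (nx e))" by (simp add: n3_funpow numeral_3_eq_3)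
      have "\<not> (P (nx e) \<and> P (nx (nx e)))" "\<not> (P (nx e) \<and> P (nx (nx (nx e))))"
        "\<not> (P (nx (nx e)) \<and> P (nx (nx (nx e))))"
        using no by metis+
      then show ?thesis using no * by (auto simp: z_def)
    qed
    have shift: "(\<Sum>e\<in>UNIV. z (g e)) = (\<Sum>e\<in>UNIV. z e)" if "inj g" for g :: "z11 \<Rightarrow> z11"
      using sum.reindex[OF that, of z] finite_UNIV_inj_surj[OF finite_z11 that] by (simp add: comp_def)
    have "card {e. P e} = (\<Sum>e\<in>UNIV. z e)"
      using finite_z11 by (simp add: z_def sum.If_cases)
    moreover have "(\<Sum>e\<in>UNIV. z e + z (nx e) + z (nx (nx e)) + z (n3 e)) \<le> (\<Sum>e\<in>(UNIV :: z11 set). 1)"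
      by (intro sum_mono win)
    moreover have "inj n3" "inj (\<lambda>e. nx (nx e))"
      using inj_compose[OF inj_nx inj_nx] inj_fn[OF inj_nx, of 3]
      by (simp_all add: comp_def n3_funpow[abs_def])
    ultimately show False
      using assms shift[OF inj_nx] shift[of n3] shift[of "\<lambda>e. nx (nx e)"] by (simp add: sum.distrib card_z11)
  qed
  then show thesis using that by (metis insertI1 insertI2 z11.distinct)
qed

primrec idx :: "z11 \<Rightarrow> nat" where
  "idx V0 = 0" | "idx V1 = 1" | "idx V2 = 2" | "idx V3 = 3" | "idx V4 = 4" | "idx V5 = 5"
| "idx V6 = 6" | "idx V7 = 7" | "idx V8 = 8" | "idx V9 = 9" | "idx V10 = 10"

text \<open>Rotations are iterates of \<open>nx\<close>; \<open>n3\<close> and \<open>nw\<close> are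
  iterates of \<open>nx\<close> as well and therefore commute with them.\<close>

lemma rotation:
  obtains r where "inj r" "r V0 = e" "\<And>x. r (nx x) = nx (r x)" "\<And>x. r (n3 x) = n3 (r x)"
    "\<And>w x. r (nw w x) = nw w (r x)"
proof -
  have "\<exists>k. (nx ^^ k) V0 = e"
  proof
    show "(nx ^^ idx e) V0 = e" by (cases e) (simp_all add: numeral_eq_Suc)
  qed
  then obtain k where k: "(nx ^^ k) V0 = e" by blast
  have "inj (nx ^^ k)" by (rule inj_fn[OF inj_nx])
  moreover have "(nx ^^ k) ((nx ^^ m) x) = (nx ^^ m) ((nx ^^ k) x)" for m x
    by (metis add.commute comp_apply funpow_add)
  ultimately show thesis
    using that[of "nx ^^ k"] k funpow_swap1[of nx k] by (simp add: n3_funpow nw_funpow)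
qed

text \<open>Here \<open>u = t + 2 * s\<close> counts all common triangles.\<close>
definition possible :: "nat \<Rightarrow> nat \<Rightarrow> bool" where
  "possible s u \<longleftrightarrow> s = 3 \<and> 7 \<le> u \<and> u \<le> 14 \<or> s = 4 \<and> 9 \<le> u \<and> u \<le> 13 \<or> s = 4 \<and> u = 15
    \<or> s = 5 \<and> 13 \<le> u \<and> u \<le> 16 \<or> s = 6 \<and> u = 14 \<or> s = 11 \<and> u = 22"

definition admits :: "bool \<Rightarrow> bool \<Rightarrow> (z11 \<Rightarrow> z11) \<Rightarrow> bool" where
  "admits w w' f = (if 3 \<le> common_blocks w w' f vertices then possible (common_blocks w w' f vertices) (common_triangles w w' f vertices) else True)"

text \<open>The search assigns images to vertices one by one (\<open>Asg\<close>) and requires that the block at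
  a given vertex becomes a common block (\<open>Chk\<close>). It is first-order, since the simplifier would
  evaluate below binders.\<close>
datatype instr = Asg z11 | Chk z11

text \<open>The default \<open>V0\<close> does not matter in the searches: \<open>wf_plan\<close>
  ensures that every check and the final evaluation concern assigned vertices only.\<close>

primrec lookup :: "(z11 \<times> z11) list \<Rightarrow> z11 \<Rightarrow> z11" where
  "lookup [] p = V0"
| "lookup (qu # acc) p = (if p = fst qu then snd qu else lookup acc p)"

function search_from :: "bool \<Rightarrow> bool \<Rightarrow> instr list \<Rightarrow> z11 list \<Rightarrow> (z11 \<times> z11) list \<Rightarrow> bool"
  and search_over :: "bool \<Rightarrow> bool \<Rightarrow> z11 \<Rightarrow> instr list \<Rightarrow> z11 list \<Rightarrow> z11 list \<Rightarrow> (z11 \<times> z11) list \<Rightarrow> bool" where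
  "search_from w w' [] us acc = admits w w' (lookup acc)"
| "search_from w w' (Chk e # is) us acc = (if common_block_at w w' (lookup acc) e then search_from w w' is us acc else True)"
| "search_from w w' (Asg p # is) us acc = search_over w w' p is us us acc"
| "search_over w w' p is [] us acc = True"
| "search_over w w' p is (x # xs) us acc =
    (if search_from w w' is (remove1 x us) ((p,x) # acc) then search_over w w' p is xs us acc else False)"
  by pat_completeness auto
termination
  by (relation "measures [\<lambda>x. case x of Inl (_,_,is,_,_) \<Rightarrow> 2 * length is | Inr (_,_,_,is,_,_,_) \<Rightarrow> 2 * length is + 1,
     \<lambda>x. case x of Inl _ \<Rightarrow> 0 | Inr (_,_,_,_,xs,_,_) \<Rightarrow> length xs]") auto

primrec wf_plan :: "bool \<Rightarrow> instr list \<Rightarrow> z11 set \<Rightarrow> bool" where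
  "wf_plan w' [] A \<longleftrightarrow> set vertices \<subseteq> A"
| "wf_plan w' (i # is) A \<longleftrightarrow> (case i of Asg p \<Rightarrow> p \<notin> A \<and> wf_plan w' is (insert p A)
    | Chk e \<Rightarrow> {e, nx e, n3 e, nw w' e} \<subseteq> A \<and> wf_plan w' is A)"

lemma search_overD: "search_over w w' p is xs us acc \<Longrightarrow> x \<in> set xs \<Longrightarrow> search_from w w' is (remove1 x us) ((p,x) # acc)"
  by (induction xs) (auto split: if_splits)

text \<open>The invariant follows the one branch that agrees with \<open>f\<close>: assigned
  vertices have their images under \<open>f\<close>, and the images of all others are still
  available in \<open>us\<close>.\<close>

lemma search_from_sound:
  assumes "search_from w w' is us acc" "wf_plan w' is (fst ` set acc)" "inj f"
    and "\<And>p. p \<in> fst ` set acc \<Longrightarrow> lookup acc p = f p"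
    and "\<And>p. p \<notin> fst ` set acc \<Longrightarrow> f p \<in> set us" "distinct us"
    and "\<And>e. Chk e \<in> set is \<Longrightarrow> common_block_at w w' f e"
  shows "admits w w' f"
  using assms
proof (induction "is" arbitrary: us acc)
  case Nil
  then have "lookup acc = f" by (auto simp: set_vertices)
  with Nil show ?case by simp
next
  case (Cons i "is")
  show ?case
  proof (cases i)
    case (Asg p)
    have p: "p \<notin> fst ` set acc" using Cons.prems(2) Asg by simp
    have "search_from w w' is (remove1 (f p) us) ((p, f p) # acc)"
      using Cons.prems(1) Asg by (auto intro: search_overD Cons.prems(5)[OF p])
    then show ?thesis
    proof (rule Cons.IH)
      show "wf_plan w' is (fst ` set ((p, f p) # acc))" using Cons.prems(2) Asg by simp
      show "q \<in> fst ` set ((p, f p) # acc) \<Longrightarrow> lookup ((p, f p) # acc) q = f q" for q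
        using Cons.prems(4) by auto
      show "q \<notin> fst ` set ((p, f p) # acc) \<Longrightarrow> f q \<in> set (remove1 (f p) us)" for q
        using Cons.prems(5,6) injD[OF Cons.prems(3)] by auto
    qed (use Cons.prems in auto)
  next
    case (Chk e)
    have "common_block_at w w' f e" using Cons.prems(7) Chk by simp
    moreover have "lookup acc p = f p" if "p \<in> {e, nx e, n3 e, nw w' e}" for p
      using Cons.prems(2,4) Chk that by auto
    ultimately have "common_block_at w w' (lookup acc) e" by (simp add: common_block_at_def)
    then have "search_from w w' is us acc" using Cons.prems(1) Chk by simp
    then show ?thesis
      by (rule Cons.IH) (use Cons.prems Chk in auto)
  qed
qed

text \<open>The base block \<open>V0, V1, V3, nw w' V0\<close> is assigned beforehand. Each plan
  completes the block at \<open>d\<close> first and checks it before branching over the other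
  vertices.\<close>

fun plan :: "bool \<Rightarrow> z11 \<Rightarrow> instr list" where
  "plan True V1 = [Asg V2, Asg V4, Asg V6, Chk V1, Asg V7, Asg V8, Asg V9, Asg V10]"
| "plan True V2 = [Asg V2, Asg V7, Chk V2, Asg V4, Asg V6, Asg V8, Asg V9, Asg V10]"
| "plan True _ = [Asg V4, Asg V6, Asg V8, Chk V3, Asg V2, Asg V7, Asg V9, Asg V10]"
| "plan False V1 = [Asg V2, Asg V4, Asg V8, Chk V1, Asg V5, Asg V6, Asg V9, Asg V10]"
| "plan False V2 = [Asg V2, Asg V5, Asg V9, Chk V2, Asg V4, Asg V6, Asg V8, Asg V10]"
| "plan False _ = [Asg V4, Asg V6, Asg V10, Chk V3, Asg V2, Asg V5, Asg V8, Asg V9]"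

text \<open>Images outside the base block of the first design, hence indexed by \<open>w\<close>,
  whereas \<open>plan\<close> follows the second design.\<close>

fun rest :: "bool \<Rightarrow> z11 list" where
  "rest True = [V2,V4,V6,V7,V8,V9,V10]"
| "rest False = [V2,V4,V5,V6,V8,V9,V10]"

text \<open>The four initial assignments are the ways to map one base block onto the other: centres
  to centres and wings to wings, each in two orders.\<close>

definition search :: "bool \<Rightarrow> bool \<Rightarrow> z11 \<Rightarrow> bool" where
  "search w w' d \<longleftrightarrow>
    search_from w w' (plan w' d) (rest w) [(V0,V0),(V1,V1),(V3,V3),(nw w' V0,nw w V0)] \<and>
    search_from w w' (plan w' d) (rest w) [(V0,V1),(V1,V0),(V3,V3),(nw w' V0,nw w V0)] \<and>
    search_from w w' (plan w' d) (rest w) [(V0,V0),(V1,V1),(V3,nw w V0),(nw w' V0,V3)] \<and>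
    search_from w w' (plan w' d) (rest w) [(V0,V1),(V1,V0),(V3,nw w V0),(nw w' V0,V3)]"

lemma search_True_True: "search True True V1" "search True True V2" "search True True V3"
  by code_simp+

lemma search_True_False: "search True False V1" "search True False V2" "search True False V3"
  by code_simp+

lemma search_False_True: "search False True V1" "search False True V2" "search False True V3"
  by code_simp+

lemma search_False_False: "search False False V1" "search False False V2" "search False False V3"
  by code_simp+

lemma search: "d \<in> {V1,V2,V3} \<Longrightarrow> search w w' d"
  using search_True_True search_True_False search_False_True search_False_False
  by (cases w; cases w') auto

lemma wf_plan: "d \<in> {V1,V2,V3} \<Longrightarrow> wf_plan w' (plan w' d) {V0,V1,V3,nw w' V0}"
  by (cases w'; elim insertE) (simp_all add: vertices_def)

lemma set_rest: "set (rest w) = - {V0,V1,V3,nw w V0}"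
proof -
  have "x \<in> set (rest w) \<longleftrightarrow> x \<notin> {V0,V1,V3,nw w V0}" for x
    by (cases x; cases w) simp_all
  then show ?thesis by blast
qed

lemma Chk_plan: "d \<in> {V1,V2,V3} \<Longrightarrow> Chk e \<in> set (plan w' d) \<Longrightarrow> e = d"
  by (cases w') auto

lemma admits_if_two_common_blocks:
  assumes "inj f" and d: "d \<in> {V1,V2,V3}" "common_block_at w w' f d"
    and c: "{f V0, f V1} = {V0,V1}" "{f V3, f (nw w' V0)} = {V3, nw w V0}"
  shows "admits w w' f"
proof -
  let ?acc = "[(V0,f V0),(V1,f V1),(V3,f V3),(nw w' V0,f (nw w' V0))]"
  have "search_from w w' (plan w' d) (rest w) ?acc"
    using search[OF d(1), of w w'] c unfolding search_def doubleton_eq_iff by auto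
  then show ?thesis
  proof (rule search_from_sound)
    show "wf_plan w' (plan w' d) (fst ` set ?acc)" using wf_plan[OF d(1), of w'] by simp
    show "lookup ?acc p = f p" if "p \<in> fst ` set ?acc" for p
      using that by auto
    show "f p \<in> set (rest w)" if "p \<notin> fst ` set ?acc" for p
    proof -
      have "f p \<notin> {f V0, f V1} \<union> {f V3, f (nw w' V0)}"
        using that injD[OF \<open>inj f\<close>, of p] by auto
      then show ?thesis unfolding c set_rest by blast
    qed
    show "distinct (rest w)" by (cases w) simp_all
    show "common_block_at w w' f e" if "Chk e \<in> set (plan w' d)" for e
      using Chk_plan[OF d(1) that] d(2) by simp
  qed (rule \<open>inj f\<close>)
qed

text \<open>Entries \<open>(w, w', us, s, t)\<close>: the bijection maps \<open>V0, ..., V10\<close> to \<open>us\<close>.\<close>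
definition examples :: "(bool \<times> bool \<times> z11 list \<times> nat \<times> nat) list" where
  "examples = [
   (True, True, [V0,V1,V2,V4,V3,V6,V5,V8,V9,V10,V7], 0, 0),
   (True, True, [V0,V1,V2,V3,V5,V4,V7,V8,V10,V6,V9], 0, 1),
   (True, True, [V0,V1,V2,V3,V4,V6,V5,V8,V9,V10,V7], 0, 2),
   (True, True, [V0,V1,V2,V3,V4,V6,V5,V8,V10,V7,V9], 0, 3),
   (True, True, [V0,V1,V2,V3,V4,V6,V5,V7,V9,V10,V8], 0, 4),
   (True, True, [V0,V1,V2,V3,V4,V6,V5,V9,V10,V8,V7], 0, 5),
   (True, True, [V0,V1,V2,V3,V4,V6,V8,V7,V9,V10,V5], 0, 6),
   (True, True, [V0,V1,V2,V3,V4,V7,V8,V6,V10,V5,V9], 0, 7),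
   (True, True, [V0,V1,V2,V3,V4,V7,V8,V9,V10,V5,V6], 0, 8),
   (True, True, [V0,V1,V2,V4,V8,V7,V6,V10,V3,V5,V9], 0, 9),
   (True, True, [V0,V1,V2,V5,V8,V7,V6,V3,V10,V4,V9], 0, 10),
   (True, True, [V0,V1,V4,V6,V9,V3,V2,V10,V7,V5,V8], 0, 11),
   (True, True, [V0,V1,V2,V4,V3,V7,V10,V5,V9,V8,V6], 1, 0),
   (True, True, [V0,V1,V2,V3,V5,V4,V10,V9,V8,V7,V6], 1, 1),
   (True, True, [V0,V1,V2,V3,V4,V5,V7,V8,V10,V6,V9], 1, 2),
   (True, True, [V0,V1,V2,V3,V4,V5,V7,V6,V9,V10,V8], 1, 3),
   (True, True, [V0,V1,V2,V3,V4,V5,V7,V9,V6,V10,V8], 1, 4),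
   (True, True, [V0,V1,V2,V3,V4,V5,V7,V9,V10,V6,V8], 1, 5),
   (True, True, [V0,V1,V2,V3,V4,V5,V8,V9,V10,V6,V7], 1, 6),
   (True, True, [V0,V1,V2,V3,V4,V5,V8,V9,V7,V10,V6], 1, 7),
   (True, True, [V0,V1,V2,V3,V7,V5,V8,V9,V10,V4,V6], 1, 8),
   (True, True, [V0,V1,V2,V3,V9,V6,V5,V7,V10,V4,V8], 1, 9),
   (True, True, [V0,V1,V2,V5,V6,V3,V9,V8,V10,V4,V7], 1, 10),
   (True, True, [V0,V1,V2,V4,V5,V10,V7,V3,V9,V8,V6], 2, 0),
   (True, True, [V0,V1,V2,V3,V4,V9,V6,V10,V8,V7,V5], 2, 1),
   (True, True, [V0,V1,V2,V3,V4,V5,V6,V8,V9,V10,V7], 2, 2),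
   (True, True, [V0,V1,V2,V3,V4,V5,V7,V6,V10,V9,V8], 2, 3),
   (True, True, [V0,V1,V2,V3,V4,V5,V6,V8,V10,V7,V9], 2, 4),
   (True, True, [V0,V1,V2,V3,V4,V5,V6,V8,V10,V9,V7], 2, 5),
   (True, True, [V0,V1,V2,V3,V4,V5,V6,V9,V10,V8,V7], 2, 6),
   (True, True, [V0,V1,V2,V3,V6,V5,V4,V9,V10,V8,V7], 2, 7),
   (True, True, [V0,V1,V2,V5,V4,V3,V10,V7,V9,V8,V6], 2, 8),
   (True, True, [V0,V1,V2,V3,V8,V7,V6,V5,V4,V10,V9], 2, 9),
   (True, True, [V0,V1,V2,V6,V5,V4,V10,V7,V8,V9,V3], 3, 1),
   (True, True, [V0,V1,V2,V3,V4,V7,V6,V10,V8,V9,V5], 3, 2),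
   (True, True, [V0,V1,V2,V3,V4,V5,V6,V8,V7,V10,V9], 3, 3),
   (True, True, [V0,V1,V2,V3,V4,V5,V6,V7,V9,V10,V8], 3, 4),
   (True, True, [V0,V1,V2,V3,V4,V5,V10,V7,V9,V8,V6], 3, 5),
   (True, True, [V0,V1,V2,V3,V6,V5,V7,V8,V4,V10,V9], 3, 6),
   (True, True, [V0,V1,V2,V3,V6,V5,V4,V10,V8,V9,V7], 3, 7),
   (True, True, [V0,V1,V2,V3,V9,V5,V6,V7,V10,V4,V8], 3, 8),
   (True, False, [V0,V5,V4,V10,V9,V3,V2,V8,V7,V6,V1], 4, 1),
   (True, False, [V0,V1,V2,V5,V4,V10,V9,V3,V6,V8,V7], 4, 2),
   (True, True, [V0,V1,V2,V3,V6,V5,V4,V8,V9,V10,V7], 4, 3),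
   (True, True, [V0,V1,V2,V3,V4,V5,V6,V10,V8,V9,V7], 4, 4),
   (True, True, [V0,V1,V2,V3,V4,V5,V6,V9,V10,V7,V8], 4, 5),
   (True, False, [V0,V1,V6,V5,V2,V10,V3,V4,V9,V8,V7], 4, 7),
   (True, True, [V0,V1,V2,V3,V6,V5,V4,V8,V7,V10,V9], 5, 3),
   (True, True, [V0,V1,V2,V3,V4,V5,V6,V7,V8,V10,V9], 5, 4),
   (True, False, [V0,V1,V6,V5,V4,V10,V9,V2,V3,V8,V7], 5, 5),
   (True, True, [V0,V1,V2,V3,V6,V5,V4,V10,V9,V8,V7], 5, 6),
   (True, True, [V0,V1,V2,V3,V4,V5,V6,V7,V10,V9,V8], 6, 2),
   (True, True, [V0,V1,V2,V3,V4,V5,V6,V7,V8,V9,V10], 11, 0)]"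

primrec check_examples :: "(bool \<times> bool \<times> z11 list \<times> nat \<times> nat) list \<Rightarrow> bool" where
  "check_examples [] = True"
| "check_examples (r # rs) = (case r of (w, w', us, s, t) \<Rightarrow>
    if distinct (map (lookup (zip vertices us)) vertices) then
      if common_blocks w w' (lookup (zip vertices us)) vertices = s then
        if common_triangles w w' (lookup (zip vertices us)) vertices = t + 2 * s then check_examples rs else False
      else False
    else False)"

lemma check_examples: "check_examples examples"
  by code_simp

subsection \<open>Intersection numbers of cyclic designs\<close>

lemma all_z11: "(\<forall>e. P e) \<longleftrightarrow> P V0 \<and> P V1 \<and> P V2 \<and> P V3 \<and> P V4 \<and> P V5 \<and> P V6 \<and> P V7 \<and> P V8 \<and> P V9 \<and> P V10"
proof -
  have "(\<forall>e. P e) \<longleftrightarrow> (\<forall>e\<in>set vertices. P e)" by (simp add: set_vertices)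
  then show ?thesis by (simp add: vertices_def)
qed

lemma ex_z11: "(\<exists>e. P e) \<longleftrightarrow> P V0 \<or> P V1 \<or> P V2 \<or> P V3 \<or> P V4 \<or> P V5 \<or> P V6 \<or> P V7 \<or> P V8 \<or> P V9 \<or> P V10"
proof -
  have "(\<exists>e. P e) \<longleftrightarrow> (\<exists>e\<in>set vertices. P e)" by (simp add: set_vertices)
  then show ?thesis by (simp add: vertices_def)
qed

section \<open>Relabelled copies of the two cyclic designs\<close>

lemma distinct_base: "distinct [e, nx e, n3 e, nw w e]"
  by (cases e; cases w) simp_all

text \<open>The edges of [0,1,3-5] have differences 1, 3, 5, 2, 4, those of [0,1,3-7] have 1, 3, 7,
  2, 6. Up to sign, each nonzero difference modulo 11 occurs exactly once in either list.\<close>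

lemma edge_unique:
  assumes "x \<noteq> y" shows "\<exists>!e. {x,y} \<in> kite e (nx e) (n3 e) (nw w e)"
  using assms
  by (cases x; cases y; cases w) (simp_all add: Ex1_def ex_z11 all_z11 kite_mem doubleton_eq_iff)

definition cyc_blk :: "bool \<Rightarrow> (z11 \<Rightarrow> 'a) \<Rightarrow> z11 \<Rightarrow> 'a set set" where
  "cyc_blk w h e = kite (h e) (h (nx e)) (h (n3 e)) (h (nw w e))"

definition cyc_design :: "bool \<Rightarrow> (z11 \<Rightarrow> 'a) \<Rightarrow> 'a set set set" where
  "cyc_design w h = range (cyc_blk w h)"

lemma distinct_cyc_blk: "inj h \<Longrightarrow> distinct [h e, h (nx e), h (n3 e), h (nw w e)]"
  using distinct_base[of e w] by (simp add: inj_eq)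

lemma pair_in_cyc_blk:
  assumes "inj h" shows "{h x, h y} \<in> cyc_blk w h e \<longleftrightarrow> {x,y} \<in> kite e (nx e) (n3 e) (nw w e)"
  by (simp add: cyc_blk_def kite_mem doubleton_eq_iff inj_eq[OF assms])

lemma is_design_cyc:
  assumes "inj h" shows "is_design (range h) (cyc_design w h)"
  unfolding is_design_def
proof (intro conjI ballI impI)
  show "finite (range h)" by (intro finite_imageI finite_z11)
  show "is_block (range h) B" if "B \<in> cyc_design w h" for B
    using that distinct_cyc_blk[OF assms] unfolding is_block_def cyc_design_def cyc_blk_def by blast
  fix x y assume "x \<in> range h" "y \<in> range h" "x \<noteq> y"
  then obtain a b where ab: "x = h a" "y = h b" "a \<noteq> b" by blast
  then obtain e where e: "{a,b} \<in> kite e (nx e) (n3 e) (nw w e)"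
    "\<And>e'. {a,b} \<in> kite e' (nx e') (n3 e') (nw w e') \<Longrightarrow> e' = e"
    using edge_unique[OF ab(3), of w] by blast
  show "\<exists>!B. B \<in> cyc_design w h \<and> {x,y} \<in> B"
  proof (rule ex1I[of _ "cyc_blk w h e"])
    show "cyc_blk w h e \<in> cyc_design w h \<and> {x,y} \<in> cyc_blk w h e"
      using e(1) by (simp add: ab cyc_design_def pair_in_cyc_blk[OF assms])
    show "B = cyc_blk w h e" if "B \<in> cyc_design w h \<and> {x,y} \<in> B" for B
      using that e(2) by (auto simp: ab cyc_design_def pair_in_cyc_blk[OF assms])
  qed
qed

lemma card_range_z11: "inj (h :: z11 \<Rightarrow> 'a) \<Longrightarrow> card (range h) = 11"
  by (simp add: card_image card_z11)

lemma design11_cyc: "inj h \<Longrightarrow> design11 (range h) (cyc_design w h)"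
  by (simp add: design11_def is_design_cyc card_range_z11)

text \<open>The degree count gives 11 blocks, as many as there are labels.\<close>

lemma inj_cyc_blk: "inj h \<Longrightarrow> inj (cyc_blk w h)"
  using design11.card_D[OF design11_cyc, of h w] eq_card_imp_inj_on[of UNIV "cyc_blk w h"] finite_z11
  by (simp add: card_z11 cyc_design_def)

lemma nx_nx: "nx (nx x) \<noteq> x" "x \<noteq> nx (nx x)"
  by (cases x; simp)+

text \<open>As \<open>nx\<close> has no cycle of length two, an unordered pair determines its
  starting vertex, and the order of the two tests is harmless.\<close>

lemma arc_ex: "(\<exists>e. {a,b} = {e, nx e} \<and> Q e) \<longleftrightarrow> (if b = nx a then Q a else if a = nx b then Q b else False)"
  using nx_nx by (cases "b = nx a") (auto simp: doubleton_eq_iff)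

lemma is_cyc_block_iff:
  assumes "distinct [a,b,c,d]"
  shows "is_cyc_block w a b c d \<longleftrightarrow> (\<exists>e. {a,b} = {e, nx e} \<and> {c,d} = {n3 e, nw w e})"
proof -
  have "(if c = n3 e then d = nw w e else if d = n3 e then c = nw w e else False) \<longleftrightarrow> {c,d} = {n3 e, nw w e}" for e
    using assms distinct_base[of e w] by (auto simp: doubleton_eq_iff)
  then show ?thesis by (simp add: arc_ex is_cyc_block_def)
qed

text \<open>Splits by the vertex that matches the apex \<open>z\<close>, which reduces triangles to
  pairs on the cycle.\<close>

lemma triple_eq_iff:
  assumes "distinct [a,b,c]" "distinct [x,y,z]"
  shows "{a,b,c} = {x,y,z} \<longleftrightarrow> ({a,b} = {x,y} \<and> c = z) \<or> ({a,c} = {x,y} \<and> b = z) \<or> ({b,c} = {x,y} \<and> a = z)"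
proof
  assume eq: "{a,b,c} = {x,y,z}"
  then have "z = c \<or> z = b \<or> z = a" by blast
  moreover have "{a,b,c} - {z} = {x,y}" using eq assms by auto
  moreover have "{a,b,c} - {c} = {a,b}" "{a,b,c} - {b} = {a,c}" "{a,b,c} - {a} = {b,c}"
    using assms(1) by auto
  ultimately show "({a,b} = {x,y} \<and> c = z) \<or> ({a,c} = {x,y} \<and> b = z) \<or> ({b,c} = {x,y} \<and> a = z)"
    by metis
next
  have "{a,b,c} = insert c {a,b}" "{a,b,c} = insert b {a,c}" "{a,b,c} = insert a {b,c}"
    "{x,y,z} = insert z {x,y}" by auto
  then show "({a,b} = {x,y} \<and> c = z) \<or> ({a,c} = {x,y} \<and> b = z) \<or> ({b,c} = {x,y} \<and> a = z) \<Longrightarrow>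
      {a,b,c} = {x,y,z}"
    by (elim disjE conjE) simp_all
qed

lemma is_arc_triangle_iff: "is_arc_triangle w a b c \<longleftrightarrow> (\<exists>e. {a,b} = {e, nx e} \<and> (c = n3 e \<or> c = nw w e))"
  by (simp add: arc_ex is_arc_triangle_def)

lemma is_cyc_triangle_iff:
  assumes "distinct [a,b,c]"
  shows "is_cyc_triangle w a b c \<longleftrightarrow> (\<exists>e. {a,b,c} = {e, nx e, n3 e} \<or> {a,b,c} = {e, nx e, nw w e})"
proof -
  have "distinct [e, nx e, n3 e]" "distinct [e, nx e, nw w e]" for e
    using distinct_base[of e w] by auto
  then show ?thesis
    unfolding is_cyc_triangle_def is_arc_triangle_iff triple_eq_iff[OF assms] by (auto simp: triple_eq_iff[OF assms])
qed

lemma kite_in_cyc_design: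
  assumes "inj h" "distinct [a,b,c,d]"
  shows "kite (h a) (h b) (h c) (h d) \<in> cyc_design w h \<longleftrightarrow> is_cyc_block w a b c d"
proof -
  have "distinct [h a, h b, h c, h d]" using assms by (simp add: inj_eq)
  then have "kite (h a) (h b) (h c) (h d) = cyc_blk w h e \<longleftrightarrow> {a,b} = {e, nx e} \<and> {c,d} = {n3 e, nw w e}" for e
    unfolding cyc_blk_def using distinct_cyc_blk[OF assms(1), of e w]
    by (subst kite_eq_iff) (simp_all add: doubleton_eq_iff inj_eq[OF assms(1)])
  then show ?thesis by (auto simp: cyc_design_def is_cyc_block_iff[OF assms(2)])
qed

lemma triangle_in_cyc_design:
  assumes "inj h" "distinct [a,b,c]"
  shows "{h a, h b, h c} \<in> triangles_of (cyc_design w h) \<longleftrightarrow> is_cyc_triangle w a b c"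
proof -
  have "{h a, h b, h c} = {h x, h y, h z} \<longleftrightarrow> {a,b,c} = {x,y,z}" for x y z
    using inj_image_eq_iff[OF assms(1), of "{a,b,c}" "{x,y,z}"] by simp
  moreover have "triangles (cyc_blk w h e) = {{h e, h (nx e), h (n3 e)}, {h e, h (nx e), h (nw w e)}}" for e
    unfolding cyc_blk_def by (rule triangles_kite[OF distinct_cyc_blk[OF assms(1)]])
  ultimately show ?thesis
    by (simp add: is_cyc_triangle_iff[OF assms(2)] triangles_of_def cyc_design_def)
qed

lemma card_common_blocks:
  assumes "inj h" "inj f"
  shows "card (cyc_design w h \<inter> cyc_design w' (h \<circ> f)) = common_blocks w w' f vertices"
proof -
  have "cyc_blk w' (h \<circ> f) e \<in> cyc_design w h \<longleftrightarrow> common_block_at w w' f e" for e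
    using kite_in_cyc_design[OF assms(1) distinct_cyc_blk[OF assms(2), of e w'], of w]
    by (simp add: cyc_blk_def common_block_at_def)
  then have "cyc_design w h \<inter> cyc_design w' (h \<circ> f) = cyc_blk w' (h \<circ> f) ` {e. common_block_at w w' f e}"
    by (auto simp: cyc_design_def[of w'])
  also have "card \<dots> = card {e. common_block_at w w' f e}"
    using inj_cyc_blk[of "h \<circ> f"] assms by (intro card_image) (auto intro: inj_compose inj_on_subset)
  finally show ?thesis using common_blocks_card[OF distinct_vertices] by (simp add: set_vertices)
qed

lemma card_common_triangles:
  assumes "inj h" "inj f"
  shows "card (triangles_of (cyc_design w h) \<inter> triangles_of (cyc_design w' (h \<circ> f))) = common_triangles w w' f vertices"
proof -
  let ?T = "triangles_of (cyc_design w h)"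
  define g where "g = h \<circ> f"
  have g: "inj g" unfolding g_def using assms by (intro inj_compose)
  have ge: "g e = h (f e)" for e by (simp add: g_def)
  have "card (?T \<inter> triangles_of (cyc_design w' g)) = (\<Sum>B\<in>cyc_design w' g. card (?T \<inter> triangles B))"
    by (rule design11.card_triangles_of_Int[OF design11_cyc[OF g]])
  also have "\<dots> = (\<Sum>e\<in>UNIV. card (?T \<inter> triangles (cyc_blk w' g e)))"
    unfolding cyc_design_def[of w'] by (simp add: sum.reindex[OF inj_cyc_blk[OF g]])
  also have "\<dots> = (\<Sum>e\<in>set vertices. (if is_cyc_triangle w (f e) (f (nx e)) (f (n3 e)) then 1 else 0) +
      (if is_cyc_triangle w (f e) (f (nx e)) (f (nw w' e)) then 1 else 0))"
    unfolding set_vertices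
  proof (rule sum.cong)
    fix e
    have d: "distinct [g e, g (nx e), g (n3 e), g (nw w' e)]" by (rule distinct_cyc_blk[OF g])
    have "distinct [f e, f (nx e), f (n3 e)]" "distinct [f e, f (nx e), f (nw w' e)]"
      using distinct_cyc_blk[OF assms(2), of e w'] by auto
    then have "{g e, g (nx e), g (n3 e)} \<in> ?T \<longleftrightarrow> is_cyc_triangle w (f e) (f (nx e)) (f (n3 e))"
      "{g e, g (nx e), g (nw w' e)} \<in> ?T \<longleftrightarrow> is_cyc_triangle w (f e) (f (nx e)) (f (nw w' e))"
      by (simp_all add: ge triangle_in_cyc_design[OF assms(1)])
    moreover have "{g e, g (nx e), g (n3 e)} \<noteq> {g e, g (nx e), g (nw w' e)}"
    proof
      assume "{g e, g (nx e), g (n3 e)} = {g e, g (nx e), g (nw w' e)}"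
      then have "g (n3 e) \<in> {g e, g (nx e), g (nw w' e)}" by blast
      then show False using d by auto
    qed
    moreover have "triangles (cyc_blk w' g e) = {{g e, g (nx e), g (n3 e)}, {g e, g (nx e), g (nw w' e)}}"
      unfolding cyc_blk_def by (rule triangles_kite[OF d])
    ultimately show "card (?T \<inter> triangles (cyc_blk w' g e)) =
        (if is_cyc_triangle w (f e) (f (nx e)) (f (n3 e)) then 1 else 0) +
        (if is_cyc_triangle w (f e) (f (nx e)) (f (nw w' e)) then 1 else 0)"
      by (simp only: Int_insert_right Int_empty_right) simp
  qed simp
  also have "\<dots> = common_triangles w w' f vertices" by (rule common_triangles_sum[OF distinct_vertices, symmetric])
  finally show ?thesis by (simp only: g_def)
qed

section \<open>Classification of the designs and reduction to the search\<close>

lemma inj_idx: "inj idx"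
proof (rule injI)
  fix x y assume "idx x = idx y" then show "x = y" by (cases x; cases y) simp_all
qed

lemma design_is_cyclic:
  assumes "is_design X D" "card X = 11"
  obtains w h where "inj (h :: z11 \<Rightarrow> 'a)" "range h = X" "D = cyc_design w h"
proof -
  interpret design11 X D using assms by unfold_locales
  obtain p k where p: "cyc 11 p" "k \<in> {5,7}"
    "\<And>i. kite (p i) (p (i + 1)) (p (i + 3)) (p (i + k)) \<in> D"
    by (rule two_designs) blast
  define h where "h e = p (idx e)" for e
  have "idx e < 11" for e by (cases e) simp_all
  then have "inj h"
    using p(1) inj_idx by (auto simp: h_def is_cycle_def inj_on_def)
  have "range h = X"
  proof (rule card_subset_eq[OF finite_X])
    show "range h \<subseteq> X" using p(1) by (auto simp: h_def)
  qed (simp add: card_range_z11 \<open>inj h\<close> card_X)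
  have mod: "p i = h e" if "i mod 11 = idx e" for i e
    using that is_cycle_mod[of cen 11 p i "idx e"] p(1) \<open>\<And>e. idx e < 11\<close> by (simp add: h_def)
  \<comment> \<open>Since \<open>k\<close> is 5 or 7, the flag \<open>k = 5\<close> selects the
    matching table of \<open>nw\<close>.\<close>
  have "h (nx e) = p (idx e + 1)" "h (n3 e) = p (idx e + 3)" "h (nw (k = 5) e) = p (idx e + k)" for e
    using p(2) by (cases e; auto intro!: mod[symmetric])+
  then have "cyc_design (k = 5) h \<subseteq> D"
    using p(3) by (auto simp: cyc_design_def cyc_blk_def h_def)
  \<comment> \<open>Inclusion suffices, because both sides have 11 blocks.\<close>
  then have "cyc_design (k = 5) h = D"
    by (intro card_subset_eq finite_D) (simp_all add: card_D design11.card_D[OF design11_cyc[OF \<open>inj h\<close>]])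
  then show thesis using that \<open>inj h\<close> \<open>range h = X\<close> by blast
qed

lemma cyc_design_rotate:
  assumes r: "inj r" "\<And>x. r (nx x) = nx (r x)" "\<And>x. r (n3 x) = n3 (r x)" "\<And>w x. r (nw w x) = nw w (r x)"
  shows "cyc_design w (h \<circ> r) = cyc_design w h" "cyc_blk w (h \<circ> r) e = cyc_blk w h (r e)"
proof -
  show *: "cyc_blk w (h \<circ> r) e = cyc_blk w h (r e)" for e by (simp add: cyc_blk_def r)
  have "range r = UNIV" using finite_UNIV_inj_surj[OF finite_z11 r(1)] .
  then show "cyc_design w (h \<circ> r) = cyc_design w h"
    unfolding cyc_design_def * by (metis (no_types, lifting) image_cong image_image)
qed

text \<open>Both labellings are rotated until a common block is the base block at \<open>V0\<close>
  in each. The transition map \<open>f\<close> between them then satisfies the hypotheses of the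
  search, with the second common block at \<open>d\<close>.\<close>

lemma intersection_possible:
  assumes "is_design X D1" "is_design X D2" "card X = 11" "3 \<le> card (D1 \<inter> D2)"
  shows "possible (card (D1 \<inter> D2)) (card (triangles_of D1 \<inter> triangles_of D2))"
proof -
  obtain w h where h: "inj h" "range h = X" "D1 = cyc_design w h" using design_is_cyclic assms(1,3) .
  obtain w' g where g: "inj g" "range g = X" "D2 = cyc_design w' g" using design_is_cyclic assms(2,3) .
  let ?P = "\<lambda>e. cyc_blk w' g e \<in> D1"
  have "D1 \<inter> D2 = cyc_blk w' g ` {e. ?P e}" by (auto simp: g(3) cyc_design_def[of w'])
  then have "card (D1 \<inter> D2) = card {e. ?P e}"
    using card_image[OF inj_on_subset[OF inj_cyc_blk[OF g(1)]]] by simp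
  then have "3 \<le> card {e. ?P e}" using assms(4) by simp
  then obtain e d where d: "d \<in> {V1,V2,V3}" "?P e"
    "d = V1 \<Longrightarrow> ?P (nx e)" "d = V2 \<Longrightarrow> ?P (nx (nx e))" "d = V3 \<Longrightarrow> ?P (n3 e)"
    by (rule close_pair) (rule that)
  obtain r where r: "inj r" "r V0 = e" "\<And>x. r (nx x) = nx (r x)" "\<And>x. r (n3 x) = n3 (r x)"
    "\<And>w x. r (nw w x) = nw w (r x)" by (rule rotation[of e]) (rule that)
  note gr = cyc_design_rotate[OF r(1,3,4,5), of w' g]
  obtain e1 where e1: "cyc_blk w' g e = cyc_blk w h e1" using d(2) by (auto simp: h(3) cyc_design_def)
  obtain q where q: "inj q" "q V0 = e1" "\<And>x. q (nx x) = nx (q x)" "\<And>x. q (n3 x) = n3 (q x)"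
    "\<And>w x. q (nw w x) = nw w (q x)" by (rule rotation[of e1]) (rule that)
  note hq = cyc_design_rotate[OF q(1,3,4,5), of w h]
  let ?h = "h \<circ> q" and ?g = "g \<circ> r"
  have inj: "inj ?h" "inj ?g" using h g q r by (auto intro: inj_compose)
  have D: "D1 = cyc_design w ?h" "D2 = cyc_design w' ?g" using h g gr hq by simp_all
  have "range ?h = X"
    using finite_UNIV_inj_surj[OF finite_z11 q(1)] h(2) by (metis image_comp)
  define f where "f x = inv ?h (?g x)" for x
  have "?g x \<in> range ?h" for x using \<open>range ?h = X\<close> g(2) by auto
  then have hf: "?h (f x) = ?g x" for x unfolding f_def by (rule f_inv_into_f)
  then have gf: "?g = ?h \<circ> f" by auto
  have "inj f" using inj(2) unfolding gf by (rule inj_on_imageI2)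
  have s: "card (D1 \<inter> D2) = common_blocks w w' f vertices" "card (triangles_of D1 \<inter> triangles_of D2) = common_triangles w w' f vertices"
    unfolding D gf using card_common_blocks[OF inj(1) \<open>inj f\<close>] card_common_triangles[OF inj(1) \<open>inj f\<close>] by simp_all
  have "admits w w' f"
  proof (rule admits_if_two_common_blocks[OF \<open>inj f\<close> d(1)])
    have "r V1 = nx e" "r V2 = nx (nx e)" "r V3 = n3 e"
      using r(3)[of V0] r(3)[of V1] r(4)[of V0] r(2) by simp_all
    then have "cyc_blk w' ?g d \<in> D1" using d gr(2) by auto
    then have "kite (?h (f d)) (?h (f (nx d))) (?h (f (n3 d))) (?h (f (nw w' d))) \<in> cyc_design w ?h"
      unfolding hf D(1) cyc_blk_def .
    then show "common_block_at w w' f d"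
      unfolding common_block_at_def kite_in_cyc_design[OF inj(1) distinct_cyc_blk[OF \<open>inj f\<close>]] .
    have "cyc_blk w' ?g V0 = cyc_blk w ?h V0" using e1 gr(2)[of V0] hq(2)[of V0] r(2) q(2) by simp
    then have "kite (?h (f V0)) (?h (f V1)) (?h (f V3)) (?h (f (nw w' V0))) =
        kite (?h V0) (?h V1) (?h V3) (?h (nw w V0))"
      unfolding hf cyc_blk_def by simp
    from kite_eqD[OF _ _ this] distinct_cyc_blk[OF inj(2), of V0 w'] distinct_cyc_blk[OF inj(1), of V0 w]
    have "?h ` {f V0, f V1} = ?h ` {V0, V1}" "?h ` {f V3, f (nw w' V0)} = ?h ` {V3, nw w V0}"
      by (simp_all add: hf flip: comp_apply[of h q] comp_apply[of g r] del: comp_apply)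
    then show "{f V0, f V1} = {V0, V1}" "{f V3, f (nw w' V0)} = {V3, nw w V0}"
      by (simp_all only: inj_image_eq_iff[OF inj(1)])
  qed
  then show ?thesis using assms(4) unfolding s by (simp add: admits_def)
qed

section \<open>Realisation of the parameters and conclusion\<close>

lemma check_examplesD: "check_examples rs \<Longrightarrow> (w, w', us, s, t) \<in> set rs \<Longrightarrow>
    distinct (map (lookup (zip vertices us)) vertices) \<and> common_blocks w w' (lookup (zip vertices us)) vertices = s \<and>
    common_triangles w w' (lookup (zip vertices us)) vertices = t + 2 * s"
  by (induction rs) (auto split: if_splits)

text \<open>The labelling \<open>idx\<close> supplies the natural numbers that \<open>Fin\<close>
  asks for; the second design is the cyclic one relabelled through the listed bijection.\<close>

lemma example_in_Fin:
  assumes "(w, w', us, s, t) \<in> set examples" shows "(s, t) \<in> Fin 11"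
proof -
  let ?f = "lookup (zip vertices us)"
  have f: "inj ?f" "common_blocks w w' ?f vertices = s" "common_triangles w w' ?f vertices = t + 2 * s"
    using check_examplesD[OF check_examples assms] by (simp_all add: distinct_map set_vertices)
  let ?D1 = "cyc_design w idx" and ?D2 = "cyc_design w' (idx \<circ> ?f)"
  have "range (idx \<circ> ?f) = range idx"
    using finite_UNIV_inj_surj[OF finite_z11 f(1)] by (metis image_comp)
  then have "is_design (range idx) ?D1" "is_design (range idx) ?D2"
    using is_design_cyc[OF inj_idx] is_design_cyc[OF inj_compose[OF inj_idx f(1)]] by metis+
  moreover have "card (?D1 \<inter> ?D2) = s" "card (triangles_of ?D1 \<inter> triangles_of ?D2) = t + 2 * s"
    by (simp_all only: card_common_blocks[OF inj_idx f(1)] card_common_triangles[OF inj_idx f(1)] f)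
  ultimately show ?thesis
    unfolding Fin_def using card_range_z11[OF inj_idx] by blast
qed

lemma possibleE:
  assumes "possible s u"
  obtains "s = 3" "7 \<le> u" "u \<le> 14" | "s = 4" "9 \<le> u" "u \<le> 13" | "s = 4" "u = 15"
    | "s = 5" "13 \<le> u" "u \<le> 16" | "s = 6" "u = 14" | "s = 11" "u = 22"
  using assms unfolding possible_def by blast

lemma example_parameters: "snd ` snd ` snd ` set examples = {
    (0,0), (0,1), (0,2), (0,3), (0,4), (0,5), (0,6), (0,7), (0,8), (0,9), (0,10), (0,11), (1,0),
    (1,1), (1,2), (1,3), (1,4), (1,5), (1,6), (1,7), (1,8), (1,9), (1,10), (2,0), (2,1), (2,2),
    (2,3), (2,4), (2,5), (2,6), (2,7), (2,8), (2,9), (3,1), (3,2), (3,3), (3,4), (3,5), (3,6),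
    (3,7), (3,8), (4,1), (4,2), (4,3), (4,4), (4,5), (4,7), (5,3), (5,4), (5,5), (5,6), (6,2),
    (11,0)}"
  by (simp add: examples_def)

lemma pair_in_Fin:
  assumes "s + t \<le> 11" "s \<le> 2 \<or> possible s (t + 2 * s)" shows "(s, t) \<in> Fin 11"
proof -
  have "(s, t) \<in> snd ` snd ` snd ` set examples"
  proof (cases "s \<le> 2")
    case True
    then consider "s = 0" | "s = 1" | "s = 2" by linarith
    then show ?thesis
    proof cases
      case 1
      then have "t = 0 \<or> t = 1 \<or> t = 2 \<or> t = 3 \<or> t = 4 \<or> t = 5 \<or> t = 6 \<or> t = 7 \<or> t = 8 \<or> t = 9 \<or> t = 10 \<or> t = 11"
        using assms(1) by presburger
      with 1 show ?thesis unfolding example_parameters by auto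
    next
      case 2
      then have "t = 0 \<or> t = 1 \<or> t = 2 \<or> t = 3 \<or> t = 4 \<or> t = 5 \<or> t = 6 \<or> t = 7 \<or> t = 8 \<or> t = 9 \<or> t = 10"
        using assms(1) by presburger
      with 2 show ?thesis unfolding example_parameters by auto
    next
      case 3
      then have "t = 0 \<or> t = 1 \<or> t = 2 \<or> t = 3 \<or> t = 4 \<or> t = 5 \<or> t = 6 \<or> t = 7 \<or> t = 8 \<or> t = 9"
        using assms(1) by presburger
      with 3 show ?thesis unfolding example_parameters by auto
    qed
  next
    case False
    then have "possible s (t + 2 * s)" using assms(2) by simp
    then show ?thesis
    proof (cases rule: possibleE)
      case 1
      then have "t = 1 \<or> t = 2 \<or> t = 3 \<or> t = 4 \<or> t = 5 \<or> t = 6 \<or> t = 7 \<or> t = 8" by presburger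
      with 1 show ?thesis unfolding example_parameters by auto
    next
      case 2
      then have "t = 1 \<or> t = 2 \<or> t = 3 \<or> t = 4 \<or> t = 5" by presburger
      with 2 show ?thesis unfolding example_parameters by auto
    next
      case 3
      then have "t = 7" by presburger
      with 3 show ?thesis unfolding example_parameters by auto
    next
      case 4
      then have "t = 3 \<or> t = 4 \<or> t = 5 \<or> t = 6" by presburger
      with 4 show ?thesis unfolding example_parameters by auto
    next
      case 5
      then have "t = 2" by presburger
      with 5 show ?thesis unfolding example_parameters by auto
    next
      case 6
      then have "t = 0" by presburger
      with 6 show ?thesis unfolding example_parameters by auto
    qed
  qed
  then show ?thesis using example_in_Fin by auto
qed

theorem theorem4p5:
  shows "Fin 11 = Adm 11 - {(3,0),(4,0),(4,6),(5,0),(5,1),(5,2),(6,0),(6,1),(6,3),(6,4)}"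
    (is "_ = _ - ?E")
proof (intro equalityI subsetI)
  fix st assume "st \<in> Fin 11"
  then obtain s t and X :: "nat set" and D1 D2 where st: "st = (s,t)"
    and D: "card X = 11" "is_design X D1" "is_design X D2" "card (D1 \<inter> D2) = s"
      "card (triangles_of D1 \<inter> triangles_of D2) = t + 2 * s"
    unfolding Fin_def by blast
  have "s + t \<le> 11"
    using common_triangles_le[of X D1 D2] D by (simp add: design11_def)
  moreover have "s \<in> J 11" "t + 2 * s \<in> J_T 11" unfolding J_def J_T_def using D by blast+
  ultimately have "st \<in> Adm 11" by (simp add: st Adm_def b_num_def)
  moreover have "st \<notin> ?E"
  proof
    assume "st \<in> ?E"
    then have "3 \<le> s" "\<not> possible s (t + 2 * s)" unfolding st by (auto simp: possible_def)
    then show False using intersection_possible[OF D(2,3,1)] unfolding D(4,5) by simp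
  qed
  ultimately show "st \<in> Adm 11 - ?E" by blast
next
  fix st assume "st \<in> Adm 11 - ?E"
  moreover obtain s t where st: "st = (s,t)" by (cases st)
  ultimately have le: "s + t \<le> 11" and J: "s \<in> J 11" and JT: "t + 2 * s \<in> J_T 11"
    and E: "(s,t) \<notin> ?E"
    by (simp_all add: Adm_def b_num_def)
  have s: "s \<le> 2 \<or> s \<in> {3,4,5,6,11}"
  proof -
    obtain X :: "nat set" and D1 D2 where "is_design X D1" "is_design X D2" "card X = 11" "card (D1 \<inter> D2) = s"
      using J unfolding J_def by blast
    then show ?thesis using intersection_possible[of X D1 D2] by (cases "3 \<le> s") (auto elim: possibleE)
  qed
  \<comment> \<open>The designs witnessing \<open>J_T\<close> may share a number of blocks other
    than \<open>s\<close>. With at most two common blocks they have at most 11 + 2 common triangles;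
    otherwise the search applies.\<close>
  have u: "t + 2 * s \<le> 16 \<or> t + 2 * s = 22"
  proof -
    obtain X :: "nat set" and D1 D2 where D: "is_design X D1" "is_design X D2" "card X = 11"
      "card (triangles_of D1 \<inter> triangles_of D2) = t + 2 * s"
      using JT unfolding J_T_def by blast
    show ?thesis
    proof (cases "3 \<le> card (D1 \<inter> D2)")
      case True
      then have "possible (card (D1 \<inter> D2)) (t + 2 * s)"
        using intersection_possible[OF D(1-3)] D(4) by simp
      then show ?thesis by (rule possibleE) simp_all
    next
      case False
      then show ?thesis using common_triangles_le[of X D1 D2] D by (simp add: design11_def)
    qed
  qed
  \<comment> \<open>Given s + t \<le> 11 and the removed pairs, \<open>u\<close> is decisive only
    for s = 6, t = 5, which would need 17 common triangles.\<close>
  have "s \<le> 2 \<or> possible s (t + 2 * s)"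
  proof -
    consider "s \<le> 2" | "s = 3" | "s = 4" | "s = 5" | "s = 6" | "s = 11" using s by auto
    moreover have "s = 3 \<longrightarrow> t \<noteq> 0" "s = 4 \<longrightarrow> t \<noteq> 0 \<and> t \<noteq> 6" "s = 5 \<longrightarrow> t \<noteq> 0 \<and> t \<noteq> 1 \<and> t \<noteq> 2"
      "s = 6 \<longrightarrow> t \<noteq> 0 \<and> t \<noteq> 1 \<and> t \<noteq> 3 \<and> t \<noteq> 4"
      using E by auto
    ultimately show ?thesis
      unfolding possible_def using u le by cases presburger+
  qed
  then show "st \<in> Fin 11" unfolding st using le by (rule pair_in_Fin[rotated])
qed

end
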